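(* Let $\Lambda=(\mathcal F,\mathcal V,\Theta,\Sigma,\mathcal R)$ be a $\lambda\Pi$-calculus satisfying the standing assumptions below, and let $\leadsto$ be a valid simplification relation on sets of equations. For every pattern $l$, sets of equations $\mathcal D,\mathcal E$, and terms $T,r$ of $\Lambda$ with $\mathrm{FV}(r)\subseteq\mathrm{FV}(l)$, if $l\uparrow T[\mathcal D]$, $\mathcal D\leadsto^*\mathcal E$ and $\vdash_{l,\mathcal E}r:T$, then the rule $l\hookrightarrow r$ preserves typing in $\Lambda$, i.e. for all environments $\Gamma$, substitutions $\sigma$ and terms $A$, if $\Gamma\vdash l\sigma:A$ then $\Gamma\vdash r\sigma:A$.
   Context: Sorts: $\mathcal S=\{\star,\Box\}$. Terms over function symbols $\mathcal F$ and variables $\mathcal V$: $t,u::=s\in\mathcal S\mid x\mid f\mid\lambda x:t,u\mid tu\mid\Pi x:t,u$, modulo renaming of bound variables. A $\lambda\Pi$-calculus $\Lambda=(\mathcal F,\mathcal V,\Theta,\Sigma,\mathcal R)$ consists of types $\Theta_f$ (written $f:\Theta_f$), sorts $\Sigma_f\in\mathcal S$, and rewriting rules $l\hookrightarrow r$ with $\mathrm{FV}(r)\subseteq\mathrm{FV}(l)$. $\hookrightarrow_{\mathcal R}$ is the closure of $\mathcal R$ under contexts and substitutions, ${\hookrightarrow}={\hookrightarrow_{\mathcal R}}\cup{\hookrightarrow_\beta}$, $\simeq$ the smallest equivalence containing $\hookrightarrow$. Typing $\Gamma\vdash t:A$: (ax) $\vdash\star:\Box$; (fun) if $\vdash\Theta_f:\Sigma_f$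 then $\vdash f:\Theta_f$; (var) if $\Gamma\vdash A:s$, $x\notin\Gamma$ then $\Gamma,x:A\vdash x:A$; (weak) if $\Gamma\vdash t:T$, $\Gamma\vdash A:s$, $x\notin\Gamma$ then $\Gamma,x:A\vdash t:T$; (prod) if $\Gamma\vdash A:\star$, $\Gamma,x:A\vdash B:s$ then $\Gamma\vdash\Pi x:A,B:s$; (app) if $\Gamma\vdash t:\Pi x:A,B$, $\Gamma\vdash a:A$ then $\Gamma\vdash ta:B\{(x,a)\}$; (abs) if $\Gamma,x:A\vdash b:B$, $\Gamma\vdash\Pi x:A,B:s$ then $\Gamma\vdash\lambda x:A,b:\Pi x:A,B$; (conv) if $\Gamma\vdash t:T$, $\Gamma\vdash U:s$, $T\simeq U$ then $\Gamma\vdash t:U$. Variables are split into algebraic and non-algebraic ones, with an injection $y\mapsto\hat y$ from algebraic to non-algebraic variables. A term is algebraic if it is an algebraic variable or $ft_1\ldots t_n$ with each $t_i$ algebraic and $\Theta_f$ of the form $\Pi x_1:A_1,\ldots,\Pi x_n:A_n,B$; object-level algebraic if moreover all its symbols have sort $\star$; a pattern is $ft_1\ldots t_n$ with each $t_i$ object-level algebraic. An equation is a pair of terms $a=b$; a substitution $\sigma$ satisfies a set $\mathcal E$ of equations, $\sigma\models\mathcal E$, if $a\sigma\simeq b\sigma$ for all $a=b\in\mathcal E$. A relation $\leadsto$ on sets of equations is a valid simplification relation if for all sets $\mathcal D,\mathcal D'$ and substitutions $\sigma$, $\sigma\models\mathcal D$ and $\mathcal D\leadsto\mathcal D'$ imply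 $\sigma\models\mathcal D'$; $\leadsto^*$ is its reflexive-transitive closure. The partial function $\uparrow$: $y\uparrow\hat y[\emptyset]$ for an algebraic variable $y$; if $f:\Pi x_1:T_1,\ldots,\Pi x_n:T_n,U$ and $t_i\uparrow A_i[\mathcal E_i]$ for all $i$, then $ft_1\ldots t_n\uparrow U\sigma[\mathcal E_1\cup\ldots\cup\mathcal E_n\cup\{A_1=T_1\sigma,\ldots,A_n=T_n\sigma\}]$ with $\sigma=\{(x_i,t_i)\}_i$. Given a pattern $l$ and set of equations $\mathcal E$ (variables of $\mathcal R$ renamed apart from $x,\hat x$, $x\in\mathrm{FV}(l)$), $\Lambda_{l,\mathcal E}$ is the $\lambda\Pi$-calculus with function symbols $\mathcal F\cup\{x,\hat x\mid x\in\mathrm{FV}(l)\}$, variables $\mathcal V\setminus\{x,\hat x\mid x\in\mathrm{FV}(l)\}$, types extended by $x:\hat x$ and $\hat x:\star$, sorts extended by $\Sigma_x=\star$, $\Sigma_{\hat x}=\Box$, and rules $\mathcal R\cup\mathcal E\cup\mathcal E^{-1}$ ($\mathcal E^{-1}$ reverses each equation); $\vdash_{l,\mathcal E}$ is its typing relation. Standing assumptions on $\Lambda$: (i) $\vdash\Theta_f:\Sigma_f$ for all $f$; (ii) $\hookrightarrow$ is confluent on untyped terms; (iii) all left-hand sides of $\mathcal R$ are patterns. *)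

theory Defs
  imports "HOL-Library.Confluence"
begin

section \<open>Terms\<close>

datatype sort = Star | Box

text \<open>
  Terms modulo renaming of bound variables, in locally nameless form: a bound variable is a
  de Bruijn index \<open>Bnd i\<close>, and \<open>LamT A b\<close>, \<open>PiT A B\<close> bind index \<open>0\<close> of \<open>b\<close>, \<open>B\<close>.
  Function symbols and free variables are both names \<open>Nm a\<close>; which names are function symbols
  and which are variables is decided by the calculus. This is what allows variables to be turned
  into function symbols by \<open>ext_calc\<close> below without changing the terms they occur in.
\<close>

datatype (names: 'a) trm =
    Srt sort
  | Nm 'a
  | Bnd nat
  | LamT "'a trm" "'a trm"
  | AppT "'a trm" "'a trm"
  | PiT "'a trm" "'a trm"

primrec closed_at :: "nat \<Rightarrow> 'a trm \<Rightarrow> bool" where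
  "closed_at k (Srt s) \<longleftrightarrow> True"
| "closed_at k (Nm a) \<longleftrightarrow> True"
| "closed_at k (Bnd i) \<longleftrightarrow> i < k"
| "closed_at k (LamT A b) \<longleftrightarrow> closed_at k A \<and> closed_at (Suc k) b"
| "closed_at k (AppT t u) \<longleftrightarrow> closed_at k t \<and> closed_at k u"
| "closed_at k (PiT A B) \<longleftrightarrow> closed_at k A \<and> closed_at (Suc k) B"

text \<open>
  \<open>inst k u t\<close> replaces index \<open>k\<close> by \<open>u\<close>, and \<open>bind k x t\<close> replaces the name \<open>x\<close> by index \<open>k\<close>.
  No index is shifted, as these are only used for terms \<open>u\<close>, \<open>t\<close> without dangling indices
  (except for index \<open>k\<close> of \<open>t\<close> in \<open>inst k u t\<close>).
\<close>

primrec inst :: "nat \<Rightarrow> 'a trm \<Rightarrow> 'a trm \<Rightarrow> 'a trm" where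
  "inst k u (Srt s) = Srt s"
| "inst k u (Nm a) = Nm a"
| "inst k u (Bnd i) = (if i = k then u else Bnd i)"
| "inst k u (LamT A b) = LamT (inst k u A) (inst (Suc k) u b)"
| "inst k u (AppT t v) = AppT (inst k u t) (inst k u v)"
| "inst k u (PiT A B) = PiT (inst k u A) (inst (Suc k) u B)"

primrec bind :: "nat \<Rightarrow> 'a \<Rightarrow> 'a trm \<Rightarrow> 'a trm" where
  "bind k x (Srt s) = Srt s"
| "bind k x (Nm a) = (if a = x then Bnd k else Nm a)"
| "bind k x (Bnd i) = Bnd i"
| "bind k x (LamT A b) = LamT (bind k x A) (bind (Suc k) x b)"
| "bind k x (AppT t v) = AppT (bind k x t) (bind k x v)"
| "bind k x (PiT A B) = PiT (bind k x A) (bind (Suc k) x B)"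

primrec subst :: "'a trm \<Rightarrow> ('a \<Rightarrow> 'a trm) \<Rightarrow> 'a trm" (infixl "\<cdot>" 75) where
  "Srt s \<cdot> \<sigma> = Srt s"
| "Nm a \<cdot> \<sigma> = \<sigma> a"
| "Bnd i \<cdot> \<sigma> = Bnd i"
| "LamT A b \<cdot> \<sigma> = LamT (A \<cdot> \<sigma>) (b \<cdot> \<sigma>)"
| "AppT t u \<cdot> \<sigma> = AppT (t \<cdot> \<sigma>) (u \<cdot> \<sigma>)"
| "PiT A B \<cdot> \<sigma> = PiT (A \<cdot> \<sigma>) (B \<cdot> \<sigma>)"

definition apps :: "'a trm \<Rightarrow> 'a trm list \<Rightarrow> 'a trm" where
  "apps t ts = foldl AppT t ts"

definition pis :: "('a \<times> 'a trm) list \<Rightarrow> 'a trm \<Rightarrow> 'a trm" where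
  "pis xTs U = foldr (\<lambda>(x, T) B. PiT T (bind 0 x B)) xTs U"

definition sub_of :: "('a \<times> 'a trm) list \<Rightarrow> 'a \<Rightarrow> 'a trm" where
  "sub_of xts a = (case map_of xts a of Some t \<Rightarrow> t | None \<Rightarrow> Nm a)"


section \<open>Calculi, rewriting and typing\<close>

type_synonym 'a eqns = "('a trm \<times> 'a trm) set"

record 'a calc =
  syms :: "'a set"
  vars :: "'a set"
  type_of :: "'a \<Rightarrow> 'a trm"
  sort_of :: "'a \<Rightarrow> sort"
  rules :: "'a eqns"

definition is_trm :: "'a calc \<Rightarrow> 'a trm \<Rightarrow> bool" where
  "is_trm \<Lambda> t \<longleftrightarrow> closed_at 0 t \<and> names t \<subseteq> syms \<Lambda> \<union> vars \<Lambda>"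

definition FV :: "'a calc \<Rightarrow> 'a trm \<Rightarrow> 'a set" where
  "FV \<Lambda> t = names t \<inter> vars \<Lambda>"

definition is_sub :: "'a calc \<Rightarrow> ('a \<Rightarrow> 'a trm) \<Rightarrow> bool" where
  "is_sub \<Lambda> \<sigma> \<longleftrightarrow> finite {a. \<sigma> a \<noteq> Nm a} \<and> {a. \<sigma> a \<noteq> Nm a} \<subseteq> vars \<Lambda> \<and>
     (\<forall>x \<in> vars \<Lambda>. is_trm \<Lambda> (\<sigma> x))"

definition is_eqns :: "'a calc \<Rightarrow> 'a eqns \<Rightarrow> bool" where
  "is_eqns \<Lambda> E \<longleftrightarrow> (\<forall>(a, b) \<in> E. is_trm \<Lambda> a \<and> is_trm \<Lambda> b)"

definition lp_calculus :: "'a calc \<Rightarrow> bool" where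
  "lp_calculus \<Lambda> \<longleftrightarrow>
     syms \<Lambda> \<inter> vars \<Lambda> = {} \<and> infinite (vars \<Lambda>) \<and>
     (\<forall>f \<in> syms \<Lambda>. is_trm \<Lambda> (type_of \<Lambda> f)) \<and>
     is_eqns \<Lambda> (rules \<Lambda>) \<and> (\<forall>(l, r) \<in> rules \<Lambda>. FV \<Lambda> r \<subseteq> FV \<Lambda> l)"

text \<open>
  Under a binder, the bodies are compared after naming the bound variable by some fresh \<open>x\<close>; the
  substitution used at the redex may thus introduce the bound variable.
\<close>

inductive ctxt_closure :: "'a calc \<Rightarrow> ('a trm \<Rightarrow> 'a trm \<Rightarrow> bool) \<Rightarrow> 'a trm \<Rightarrow> 'a trm \<Rightarrow> bool"
  for \<Lambda> P where
  root: "P t u \<Longrightarrow> ctxt_closure \<Lambda> P t u"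
| lam_dom: "ctxt_closure \<Lambda> P A A' \<Longrightarrow> is_trm \<Lambda> (LamT A b) \<Longrightarrow>
    ctxt_closure \<Lambda> P (LamT A b) (LamT A' b)"
| lam_body: "is_trm \<Lambda> A \<Longrightarrow> x \<in> vars \<Lambda> \<Longrightarrow> x \<notin> names b \<union> names b' \<Longrightarrow>
    ctxt_closure \<Lambda> P (inst 0 (Nm x) b) (inst 0 (Nm x) b') \<Longrightarrow>
    ctxt_closure \<Lambda> P (LamT A b) (LamT A b')"
| app_fun: "ctxt_closure \<Lambda> P t t' \<Longrightarrow> is_trm \<Lambda> u \<Longrightarrow> ctxt_closure \<Lambda> P (AppT t u) (AppT t' u)"
| app_arg: "is_trm \<Lambda> t \<Longrightarrow> ctxt_closure \<Lambda> P u u' \<Longrightarrow> ctxt_closure \<Lambda> P (AppT t u) (AppT t u')"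
| pi_dom: "ctxt_closure \<Lambda> P A A' \<Longrightarrow> is_trm \<Lambda> (PiT A B) \<Longrightarrow>
    ctxt_closure \<Lambda> P (PiT A B) (PiT A' B)"
| pi_cod: "is_trm \<Lambda> A \<Longrightarrow> x \<in> vars \<Lambda> \<Longrightarrow> x \<notin> names B \<union> names B' \<Longrightarrow>
    ctxt_closure \<Lambda> P (inst 0 (Nm x) B) (inst 0 (Nm x) B') \<Longrightarrow>
    ctxt_closure \<Lambda> P (PiT A B) (PiT A B')"

definition rule_instance :: "'a calc \<Rightarrow> 'a trm \<Rightarrow> 'a trm \<Rightarrow> bool" where
  "rule_instance \<Lambda> t u \<longleftrightarrow>
     (\<exists>l r \<sigma>. (l, r) \<in> rules \<Lambda> \<and> is_sub \<Lambda> \<sigma> \<and> t = l \<cdot> \<sigma> \<and> u = r \<cdot> \<sigma>)"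

definition beta_redex :: "'a calc \<Rightarrow> 'a trm \<Rightarrow> 'a trm \<Rightarrow> bool" where
  "beta_redex \<Lambda> t u \<longleftrightarrow>
     is_trm \<Lambda> t \<and> (\<exists>A b a. t = AppT (LamT A b) a \<and> u = inst 0 a b)"

definition red_R :: "'a calc \<Rightarrow> 'a trm \<Rightarrow> 'a trm \<Rightarrow> bool" where
  "red_R \<Lambda> = ctxt_closure \<Lambda> (rule_instance \<Lambda>)"

definition red_beta :: "'a calc \<Rightarrow> 'a trm \<Rightarrow> 'a trm \<Rightarrow> bool" where
  "red_beta \<Lambda> = ctxt_closure \<Lambda> (beta_redex \<Lambda>)"

definition red :: "'a calc \<Rightarrow> 'a trm \<Rightarrow> 'a trm \<Rightarrow> bool" where
  "red \<Lambda> t u \<longleftrightarrow> red_R \<Lambda> t u \<or> red_beta \<Lambda> t u"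

definition conv :: "'a calc \<Rightarrow> 'a trm \<Rightarrow> 'a trm \<Rightarrow> bool" where
  "conv \<Lambda> = equivclp (red \<Lambda>)"

text \<open>
  An environment is a list with the most recent declaration first: \<open>(x, A) # \<Gamma>\<close> stands for
  \<open>\<Gamma>, x : A\<close>.
\<close>

type_synonym 'a env = "('a \<times> 'a trm) list"

inductive typing :: "'a calc \<Rightarrow> 'a env \<Rightarrow> 'a trm \<Rightarrow> 'a trm \<Rightarrow> bool"
  for \<Lambda> where
  ty_ax: "typing \<Lambda> [] (Srt Star) (Srt Box)"
| ty_fun: "f \<in> syms \<Lambda> \<Longrightarrow> typing \<Lambda> [] (type_of \<Lambda> f) (Srt (sort_of \<Lambda> f)) \<Longrightarrow>
    typing \<Lambda> [] (Nm f) (type_of \<Lambda> f)"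
| ty_var: "typing \<Lambda> \<Gamma> A (Srt s) \<Longrightarrow> x \<in> vars \<Lambda> \<Longrightarrow> x \<notin> fst ` set \<Gamma> \<Longrightarrow>
    typing \<Lambda> ((x, A) # \<Gamma>) (Nm x) A"
| ty_weak: "typing \<Lambda> \<Gamma> t T \<Longrightarrow> typing \<Lambda> \<Gamma> A (Srt s) \<Longrightarrow> x \<in> vars \<Lambda> \<Longrightarrow> x \<notin> fst ` set \<Gamma> \<Longrightarrow>
    typing \<Lambda> ((x, A) # \<Gamma>) t T"
| ty_prod: "typing \<Lambda> \<Gamma> A (Srt Star) \<Longrightarrow> x \<notin> names B \<Longrightarrow>
    typing \<Lambda> ((x, A) # \<Gamma>) (inst 0 (Nm x) B) (Srt s) \<Longrightarrow>
    typing \<Lambda> \<Gamma> (PiT A B) (Srt s)"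
| ty_app: "typing \<Lambda> \<Gamma> t (PiT A B) \<Longrightarrow> typing \<Lambda> \<Gamma> a A \<Longrightarrow>
    typing \<Lambda> \<Gamma> (AppT t a) (inst 0 a B)"
| ty_abs: "x \<notin> names b \<union> names B \<Longrightarrow>
    typing \<Lambda> ((x, A) # \<Gamma>) (inst 0 (Nm x) b) (inst 0 (Nm x) B) \<Longrightarrow>
    typing \<Lambda> \<Gamma> (PiT A B) (Srt s) \<Longrightarrow>
    typing \<Lambda> \<Gamma> (LamT A b) (PiT A B)"
| ty_conv: "typing \<Lambda> \<Gamma> t T \<Longrightarrow> typing \<Lambda> \<Gamma> U (Srt s) \<Longrightarrow> conv \<Lambda> T U \<Longrightarrow>
    typing \<Lambda> \<Gamma> t U"

definition preserves_typing :: "'a calc \<Rightarrow> 'a trm \<Rightarrow> 'a trm \<Rightarrow> bool" where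
  "preserves_typing \<Lambda> l r \<longleftrightarrow>
     (\<forall>\<Gamma> \<sigma> A. is_sub \<Lambda> \<sigma> \<longrightarrow> typing \<Lambda> \<Gamma> (l \<cdot> \<sigma>) A \<longrightarrow> typing \<Lambda> \<Gamma> (r \<cdot> \<sigma>) A)"


section \<open>Algebraic terms, patterns and inferred types\<close>

definition alg_split :: "'a calc \<Rightarrow> 'a set \<Rightarrow> ('a \<Rightarrow> 'a) \<Rightarrow> bool" where
  "alg_split \<Lambda> alg hat \<longleftrightarrow> alg \<subseteq> vars \<Lambda> \<and> hat ` alg \<subseteq> vars \<Lambda> - alg \<and> inj_on hat alg"

text \<open>
  \<open>has_prod \<Lambda> f xTs U\<close>: the type of \<open>f\<close> is \<open>\<Pi>x\<^sub>1:T\<^sub>1, \<dots>, \<Pi>x\<^sub>n:T\<^sub>n, U\<close>, for some choice of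
  distinct names \<open>x\<^sub>i\<close> for its bound variables.
\<close>

definition has_prod :: "'a calc \<Rightarrow> 'a \<Rightarrow> ('a \<times> 'a trm) list \<Rightarrow> 'a trm \<Rightarrow> bool" where
  "has_prod \<Lambda> f xTs U \<longleftrightarrow>
     type_of \<Lambda> f = pis xTs U \<and> distinct (map fst xTs) \<and> is_trm \<Lambda> U \<and>
     (\<forall>(x, T) \<in> set xTs. x \<in> vars \<Lambda> \<and> is_trm \<Lambda> T)"

inductive algebraic :: "'a calc \<Rightarrow> 'a set \<Rightarrow> 'a trm \<Rightarrow> bool"
  for \<Lambda> alg where
  alg_var: "y \<in> alg \<Longrightarrow> algebraic \<Lambda> alg (Nm y)"
| alg_app: "f \<in> syms \<Lambda> \<Longrightarrow> has_prod \<Lambda> f xTs U \<Longrightarrow> length ts = length xTs \<Longrightarrow>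
    (\<And>t. t \<in> set ts \<Longrightarrow> algebraic \<Lambda> alg t) \<Longrightarrow> algebraic \<Lambda> alg (apps (Nm f) ts)"

definition obj_algebraic :: "'a calc \<Rightarrow> 'a set \<Rightarrow> 'a trm \<Rightarrow> bool" where
  "obj_algebraic \<Lambda> alg t \<longleftrightarrow>
     algebraic \<Lambda> alg t \<and> (\<forall>f \<in> names t \<inter> syms \<Lambda>. sort_of \<Lambda> f = Star)"

definition pattern :: "'a calc \<Rightarrow> 'a set \<Rightarrow> 'a trm \<Rightarrow> bool" where
  "pattern \<Lambda> alg l \<longleftrightarrow>
     (\<exists>f ts. f \<in> syms \<Lambda> \<and> l = apps (Nm f) ts \<and> (\<forall>t \<in> set ts. obj_algebraic \<Lambda> alg t))"

text \<open>\<open>infer \<Lambda> alg hat t T E\<close> is the relation \<open>t \<up> T[E]\<close>.\<close>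

inductive infer :: "'a calc \<Rightarrow> 'a set \<Rightarrow> ('a \<Rightarrow> 'a) \<Rightarrow> 'a trm \<Rightarrow> 'a trm \<Rightarrow> 'a eqns \<Rightarrow> bool"
  for \<Lambda> alg hat where
  infer_var: "y \<in> alg \<Longrightarrow> infer \<Lambda> alg hat (Nm y) (Nm (hat y)) {}"
| infer_app: "f \<in> syms \<Lambda> \<Longrightarrow> has_prod \<Lambda> f xTs U \<Longrightarrow>
    length ts = length xTs \<Longrightarrow> length As = length xTs \<Longrightarrow> length Es = length xTs \<Longrightarrow>
    (\<And>i. i < length xTs \<Longrightarrow> infer \<Lambda> alg hat (ts ! i) (As ! i) (Es ! i)) \<Longrightarrow>
    \<sigma> = sub_of (zip (map fst xTs) ts) \<Longrightarrow>
    infer \<Lambda> alg hat (apps (Nm f) ts) (U \<cdot> \<sigma>)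
      (\<Union> (set Es) \<union> {(As ! i, snd (xTs ! i) \<cdot> \<sigma>) | i. i < length xTs})"


section \<open>Equations and their simplification\<close>

definition satisfies :: "'a calc \<Rightarrow> ('a \<Rightarrow> 'a trm) \<Rightarrow> 'a eqns \<Rightarrow> bool" where
  "satisfies \<Lambda> \<sigma> E \<longleftrightarrow> (\<forall>(a, b) \<in> E. conv \<Lambda> (a \<cdot> \<sigma>) (b \<cdot> \<sigma>))"

definition valid_simplification :: "'a calc \<Rightarrow> ('a eqns \<Rightarrow> 'a eqns \<Rightarrow> bool) \<Rightarrow> bool" where
  "valid_simplification \<Lambda> S \<longleftrightarrow>
     (\<forall>D D'. S D D' \<longrightarrow> is_eqns \<Lambda> D \<and> is_eqns \<Lambda> D') \<and>
     (\<forall>D D' \<sigma>. is_sub \<Lambda> \<sigma> \<longrightarrow> satisfies \<Lambda> \<sigma> D \<longrightarrow> S D D' \<longrightarrow> satisfies \<Lambda> \<sigma> D')"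

text \<open>
  The rules of \<open>\<Lambda>\<close> have to be renamed apart from the variables that become function symbols.
  Instead of choosing one renaming per rule, \<open>variants_apart\<close> collects all of them; since
  rewriting is closed under substitution, this gives the same rewrite relation.
\<close>

definition renaming :: "'a calc \<Rightarrow> ('a \<Rightarrow> 'a trm) \<Rightarrow> bool" where
  "renaming \<Lambda> \<rho> \<longleftrightarrow> is_sub \<Lambda> \<rho> \<and> inj \<rho> \<and> (\<forall>x \<in> vars \<Lambda>. \<exists>y \<in> vars \<Lambda>. \<rho> x = Nm y)"

definition variants_apart :: "'a calc \<Rightarrow> 'a set \<Rightarrow> 'a eqns" where
  "variants_apart \<Lambda> X =
     {(l \<cdot> \<rho>, r \<cdot> \<rho>) | l r \<rho>. (l, r) \<in> rules \<Lambda> \<and> renaming \<Lambda> \<rho> \<and>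
        (FV \<Lambda> (l \<cdot> \<rho>) \<union> FV \<Lambda> (r \<cdot> \<rho>)) \<inter> X = {}}"

definition ext_calc :: "'a calc \<Rightarrow> ('a \<Rightarrow> 'a) \<Rightarrow> 'a trm \<Rightarrow> 'a eqns \<Rightarrow> 'a calc" where
  "ext_calc \<Lambda> hat l E =
     (let X = FV \<Lambda> l; Y = hat ` X in
      \<lparr> syms = syms \<Lambda> \<union> (X \<union> Y),
        vars = vars \<Lambda> - (X \<union> Y),
        type_of = (\<lambda>a. if a \<in> X then Nm (hat a) else if a \<in> Y then Srt Star else type_of \<Lambda> a),
        sort_of = (\<lambda>a. if a \<in> X then Star else if a \<in> Y then Box else sort_of \<Lambda> a),
        rules = variants_apart \<Lambda> (X \<union> Y) \<union> E \<union> E\<inverse> \<rparr>)"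

end

theory Submission
  imports Defs
begin

text \<open>
  Given \<open>\<Gamma> \<turnstile> l\<sigma> : A\<close>, extend \<open>\<sigma>\<close> by sending \<open>hat y\<close> to a type of \<open>y\<sigma>\<close>. Types are unique up to
  conversion: by confluence products are injective, since no rule rewrites a product at the root.
  Hence the extended substitution satisfies the equations \<open>D\<close> inferred from \<open>l\<close>, and \<open>A\<close> is
  convertible to \<open>T\<sigma>\<close>; by validity it also satisfies \<open>E\<close>. It thus maps the symbols of the extended
  calculus to terms of the right types and its conversion into that of \<open>\<Lambda>\<close>, so it translates the
  derivation of \<open>r : T\<close> into one of \<open>\<Gamma> \<turnstile> r\<sigma> : T\<sigma>\<close>. Subject reduction is never needed: \<open>l\<sigma>\<close> is an
  applied symbol, so \<open>A\<close> is itself typable and (conv) applies.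
\<close>

section \<open>Terms\<close>

lemma finite_names [simp]: "finite (names t)"
  by (induction t) auto

lemma closed_at_mono: "closed_at k t \<Longrightarrow> k \<le> k' \<Longrightarrow> closed_at k' t"
  by (induction t arbitrary: k k') fastforce+

lemma inst_closed_at: "closed_at k t \<Longrightarrow> inst k u t = t"
  by (induction t arbitrary: k) auto

lemma names_subst: "names (t \<cdot> \<theta>) = (\<Union>a\<in>names t. names (\<theta> a))"
  by (induction t) auto

lemma closed_at_subst: "\<lbrakk>\<And>a. closed_at 0 (\<theta> a); closed_at k t\<rbrakk> \<Longrightarrow> closed_at k (t \<cdot> \<theta>)"
  by (induction t arbitrary: k) (auto intro: closed_at_mono)

lemma subst_cong: "(\<And>a. a \<in> names t \<Longrightarrow> \<theta> a = \<theta>' a) \<Longrightarrow> t \<cdot> \<theta> = t \<cdot> \<theta>'"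
  by (induction t) auto

lemma subst_Nm [simp]: "t \<cdot> Nm = t"
  by (induction t) auto

lemma subst_subst: "t \<cdot> \<theta> \<cdot> \<tau> = t \<cdot> (\<lambda>a. \<theta> a \<cdot> \<tau>)"
  by (induction t) auto

text \<open>The images of \<open>\<theta>\<close> have no dangling index, so \<open>inst\<close>
  leaves them alone; this matters at the names of \<open>t\<close>.\<close>

lemma inst_subst:
  assumes "\<And>a. closed_at 0 (\<theta> a)"
  shows "inst k u t \<cdot> \<theta> = inst k (u \<cdot> \<theta>) (t \<cdot> \<theta>)"
proof (induction t arbitrary: k)
  case (Nm a)
  show ?case using inst_closed_at[OF closed_at_mono[OF assms]] by simp
qed auto

text \<open>Moves a substitution under a binder opened at a fresh name \<open>x\<close>. With
  \<open>v\<close> a variable this renames the bound variable; with \<open>v\<close> a term it is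
  the instantiation that (app) performs.\<close>

lemma inst_Nm_subst:
  assumes "\<And>a. closed_at 0 (\<theta> a)" "closed_at 0 v" "x \<notin> names t"
  shows "inst k (Nm x) t \<cdot> \<theta>(x := v) = inst k v (t \<cdot> \<theta>)"
proof -
  have "t \<cdot> \<theta>(x := v) = t \<cdot> \<theta>" using assms(3) by (intro subst_cong) auto
  then show ?thesis using assms(1,2) by (subst inst_subst) auto
qed

lemma bind_inst: "x \<notin> names t \<Longrightarrow> bind k x (inst k (Nm x) t) = t"
  by (induction t arbitrary: k) auto

text \<open>\<open>bind\<close> hides \<open>x\<close> from \<open>\<theta>\<close>, and
  \<open>inst\<close> then puts \<open>u\<close> in its place. This turns instantiating the codomain
  of a \<open>pis\<close> product into updating a substitution.\<close>

lemma inst_bind_subst: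
  assumes "\<And>a. closed_at 0 (\<theta> a)"
  shows "closed_at k t \<Longrightarrow> inst k u (bind k x t \<cdot> \<theta>) = t \<cdot> \<theta>(x := u)"
proof (induction t arbitrary: k)
  case (Nm a)
  show ?case using inst_closed_at[OF closed_at_mono[OF assms]] by simp
qed auto

lemma names_inst: "names (inst k u t) \<subseteq> names u \<union> names t"
  by (induction t arbitrary: k) auto

lemma names_inst_ge: "names t \<subseteq> names (inst k u t)"
  by (induction t arbitrary: k) fastforce+

lemma names_bind [simp]: "names (bind k x t) = names t - {x}"
  by (induction t arbitrary: k) auto

lemma closed_at_inst: "closed_at (Suc k) t \<Longrightarrow> closed_at 0 u \<Longrightarrow> closed_at k (inst k u t)"
  by (induction t arbitrary: k) (auto intro: closed_at_mono)

lemma closed_at_instD: "closed_at k (inst k u t) \<Longrightarrow> closed_at (Suc k) t"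
  by (induction t arbitrary: k) (auto split: if_splits)

lemma closed_at_bind: "closed_at k t \<Longrightarrow> closed_at (Suc k) (bind k x t)"
  by (induction t arbitrary: k) auto

lemma inst_bind: "closed_at k t \<Longrightarrow> inst k (Nm x) (bind k x t) = t"
  using inst_bind_subst[of Nm k t "Nm x" x] by simp

lemma size_inst_Nm [simp]: "size (inst k (Nm x) t) = size t"
  by (induction t arbitrary: k) auto

section \<open>Iterated applications and products\<close>

lemma apps_snoc [simp]: "apps t (ts @ [u]) = AppT (apps t ts) u"
  by (simp add: apps_def)

lemma apps_Nil [simp]: "apps t [] = t"
  by (simp add: apps_def)

lemma apps_subst: "apps t ts \<cdot> \<theta> = apps (t \<cdot> \<theta>) (map (\<lambda>u. u \<cdot> \<theta>) ts)"
  by (induction ts rule: rev_induct) auto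

lemma names_apps: "names (apps t ts) = names t \<union> (\<Union>u\<in>set ts. names u)"
  by (induction ts rule: rev_induct) auto

lemma apps_Nm_neq [simp]:
  "apps (Nm f) ts \<noteq> PiT A B" "apps (Nm f) ts \<noteq> Srt s"
  by (induction ts rule: rev_induct) auto

lemma apps_Nm_eq_Nm [simp]: "apps (Nm f) ts = Nm x \<longleftrightarrow> f = x \<and> ts = []"
  by (induction ts rule: rev_induct) auto

lemma pis_Nil [simp]: "pis [] U = U"
  by (simp add: pis_def)

lemma pis_Cons [simp]: "pis ((x, T) # xTs) U = PiT T (bind 0 x (pis xTs U))"
  by (simp add: pis_def)

lemma pis_snoc: "pis (xTs @ [(x, T)]) U = pis xTs (PiT T (bind 0 x U))"
  by (simp add: pis_def)

lemma names_pis_cod: "names U \<subseteq> names (pis xTs U) \<union> fst ` set xTs"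
  by (induction xTs) auto

text \<open>A domain lies under the binders to its left only, so \<open>bind\<close> removes no
  names from it but those declared earlier.\<close>

lemma names_pis_dom:
  "i < length xTs \<Longrightarrow> names (snd (xTs ! i)) \<subseteq> names (pis xTs U) \<union> fst ` set (take i xTs)"
proof (induction xTs arbitrary: i)
  case (Cons p xTs)
  then show ?case by (cases i; cases p) fastforce+
qed simp

section \<open>Well-formed terms and substitutions\<close>

lemma is_trm_simps [simp]:
  "is_trm \<Lambda> (Srt s)"
  "is_trm \<Lambda> (Nm a) \<longleftrightarrow> a \<in> syms \<Lambda> \<union> vars \<Lambda>"
  "is_trm \<Lambda> (AppT t u) \<longleftrightarrow> is_trm \<Lambda> t \<and> is_trm \<Lambda> u"
  by (auto simp: is_trm_def)

lemma is_trm_PiT: "is_trm \<Lambda> (PiT A B) \<longleftrightarrow> is_trm \<Lambda> A \<and> is_trm \<Lambda> (LamT A B)"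
  and is_trm_LamT: "is_trm \<Lambda> (LamT A B) \<longleftrightarrow>
    is_trm \<Lambda> A \<and> closed_at 1 B \<and> names B \<subseteq> syms \<Lambda> \<union> vars \<Lambda>"
  by (auto simp: is_trm_def)

lemma is_trm_subst:
  assumes "\<And>a. closed_at 0 (\<theta> a)" "\<And>a. a \<in> syms \<Lambda> \<union> vars \<Lambda> \<Longrightarrow> is_trm \<Lambda>' (\<theta> a)" "is_trm \<Lambda> t"
  shows "is_trm \<Lambda>' (t \<cdot> \<theta>)"
  using assms closed_at_subst[of \<theta> 0 t] unfolding is_trm_def names_subst by blast

lemma is_trm_inst:
  assumes "closed_at 1 B" "names B \<subseteq> syms \<Lambda> \<union> vars \<Lambda>" "is_trm \<Lambda> u"
  shows "is_trm \<Lambda> (inst 0 u B)"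
  using assms closed_at_inst[of 0 B u] names_inst[of 0 u B] unfolding is_trm_def by auto

lemma is_trm_instD:
  assumes "is_trm \<Lambda> (inst 0 u B)"
  shows "closed_at 1 B \<and> names B \<subseteq> syms \<Lambda> \<union> vars \<Lambda>"
  using assms closed_at_instD[of 0 u B] names_inst_ge[of B 0 u] unfolding is_trm_def by auto

lemma is_subD:
  assumes "is_sub \<Lambda> \<sigma>"
  shows is_sub_fixes: "a \<notin> vars \<Lambda> \<Longrightarrow> \<sigma> a = Nm a"
    and is_sub_closed: "closed_at 0 (\<sigma> a)"
    and is_sub_trm: "a \<in> syms \<Lambda> \<union> vars \<Lambda> \<Longrightarrow> is_trm \<Lambda> (\<sigma> a)"
proof -
  show *: "\<sigma> a = Nm a" if "a \<notin> vars \<Lambda>" for a using assms that by (auto simp: is_sub_def)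
  show "closed_at 0 (\<sigma> a)"
    using assms * [of a] by (cases "a \<in> vars \<Lambda>") (auto simp: is_sub_def is_trm_def)
  show "is_trm \<Lambda> (\<sigma> a)" if "a \<in> syms \<Lambda> \<union> vars \<Lambda>"
    using assms * [of a] that by (cases "a \<in> vars \<Lambda>") (auto simp: is_sub_def)
qed

lemma is_sub_is_trm: "is_sub \<Lambda> \<sigma> \<Longrightarrow> is_trm \<Lambda> t \<Longrightarrow> is_trm \<Lambda> (t \<cdot> \<sigma>)"
  by (rule is_trm_subst) (auto dest: is_sub_closed is_sub_trm)

lemma is_sub_Nm [simp]: "is_sub \<Lambda> Nm"
  by (simp add: is_sub_def)

lemma is_sub_upd:
  assumes "is_sub \<Lambda> \<sigma>" "x \<in> vars \<Lambda>" "is_trm \<Lambda> u"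
  shows "is_sub \<Lambda> (\<sigma>(x := u))"
proof -
  have "{a. (\<sigma>(x := u)) a \<noteq> Nm a} \<subseteq> insert x {a. \<sigma> a \<noteq> Nm a}" by auto
  then show ?thesis using assms unfolding is_sub_def
    by (auto intro: finite_subset split: if_splits)
qed

section \<open>Reduction and conversion\<close>

lemma conv_refl [simp, intro]: "conv \<Lambda> t t"
  by (simp add: conv_def)

lemma conv_sym: "conv \<Lambda> t u \<Longrightarrow> conv \<Lambda> u t"
  unfolding conv_def by (rule equivclp_sym)

lemma conv_trans [trans]: "conv \<Lambda> t u \<Longrightarrow> conv \<Lambda> u v \<Longrightarrow> conv \<Lambda> t v"
  unfolding conv_def by (rule equivclp_trans)

lemma red_conv: "red \<Lambda> t u \<Longrightarrow> conv \<Lambda> t u"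
  unfolding conv_def by (rule r_into_equivclp)

text \<open>Since the target relation is an equivalence, it suffices to follow single steps.
  Congruence of \<open>conv\<close> and its stability under translations are instances.\<close>

lemma conv_map:
  assumes "\<And>t u. red \<Lambda> t u \<Longrightarrow> conv \<Lambda>' (h t) (h u)" "conv \<Lambda> t u"
  shows "conv \<Lambda>' (h t) (h u)"
  using assms(2) unfolding conv_def
proof (induction rule: equivclp_induct)
  case (step y z)
  then show ?case using assms(1) conv_sym conv_trans unfolding conv_def by metis
qed simp

lemma red_cases:
  assumes "red \<Lambda> t u"
  obtains P where "P = rule_instance \<Lambda> \<or> P = beta_redex \<Lambda>" "ctxt_closure \<Lambda> P t u"
  using assms by (auto simp: red_def red_R_def red_beta_def)

lemma redI: "ctxt_closure \<Lambda> P t u \<Longrightarrow> P = rule_instance \<Lambda> \<or> P = beta_redex \<Lambda> \<Longrightarrow> red \<Lambda> t u"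
  by (auto simp: red_def red_R_def red_beta_def)

locale calculus =
  fixes \<Lambda> :: "'a calc"
  assumes lp: "lp_calculus \<Lambda>"
begin

lemma disj: "syms \<Lambda> \<inter> vars \<Lambda> = {}"
  using lp by (simp add: lp_calculus_def)

lemma fresh:
  assumes "finite F"
  obtains z where "z \<in> vars \<Lambda>" "z \<notin> F"
  using assms lp unfolding lp_calculus_def by (meson finite_subset subsetI)

text \<open>The rules of \<open>ctxt_closure\<close> ask for well-formed side terms, so the terms
  met along a conversion must be known to be well-formed.\<close>

lemma red_is_trm:
  assumes "red \<Lambda> t u"
  shows "is_trm \<Lambda> t" "is_trm \<Lambda> u"
proof -
  have root_is_trm: "is_trm \<Lambda> t \<and> is_trm \<Lambda> u" if P: "P t u" "P = rule_instance \<Lambda> \<or> P = beta_redex \<Lambda>"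
    for P and t u
    using P(2)
  proof
    assume "P = rule_instance \<Lambda>"
    then obtain l r \<sigma> where *: "(l, r) \<in> rules \<Lambda>" "is_sub \<Lambda> \<sigma>" "t = l \<cdot> \<sigma>" "u = r \<cdot> \<sigma>"
      using P(1) by (auto simp: rule_instance_def)
    then have "is_trm \<Lambda> l" "is_trm \<Lambda> r" using lp by (auto simp: lp_calculus_def is_eqns_def)
    then show ?thesis using * by (auto intro: is_sub_is_trm)
  next
    assume "P = beta_redex \<Lambda>"
    then show ?thesis using P(1)
      by (auto simp: beta_redex_def is_trm_LamT intro!: is_trm_inst)
  qed
  have "is_trm \<Lambda> t \<and> is_trm \<Lambda> u"
    if "ctxt_closure \<Lambda> P t u" "P = rule_instance \<Lambda> \<or> P = beta_redex \<Lambda>" for P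
    using that
  proof (induction rule: ctxt_closure.induct)
    case (root t u)
    then show ?case using root_is_trm by blast
  qed (auto simp: is_trm_PiT is_trm_LamT dest!: is_trm_instD)
  then show "is_trm \<Lambda> t" "is_trm \<Lambda> u" using assms by (auto elim: red_cases)
qed

section \<open>Congruence of conversion\<close>

lemma conv_AppT_left:
  assumes "conv \<Lambda> t t'" "is_trm \<Lambda> u"
  shows "conv \<Lambda> (AppT t u) (AppT t' u)"
  using assms(1) by (rule conv_map[rotated])
    (use assms(2) in \<open>auto elim!: red_cases intro!: red_conv intro: redI ctxt_closure.app_fun\<close>)

lemma conv_AppT_right:
  assumes "conv \<Lambda> u u'" "is_trm \<Lambda> t"
  shows "conv \<Lambda> (AppT t u) (AppT t u')"
  using assms(1) by (rule conv_map[rotated])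
    (use assms(2) in \<open>auto elim!: red_cases intro!: red_conv intro: redI ctxt_closure.app_arg\<close>)

lemma conv_LamT_dom:
  assumes "conv \<Lambda> A A'" "closed_at 1 b" "names b \<subseteq> syms \<Lambda> \<union> vars \<Lambda>"
  shows "conv \<Lambda> (LamT A b) (LamT A' b)"
  using assms(1)
proof (rule conv_map[rotated])
  fix t u assume r: "red \<Lambda> t u"
  then have "is_trm \<Lambda> (LamT t b)" using assms red_is_trm by (auto simp: is_trm_LamT)
  with r show "conv \<Lambda> (LamT t b) (LamT u b)"
    by (auto elim!: red_cases intro!: red_conv intro: redI ctxt_closure.lam_dom)
qed

lemma conv_PiT_dom:
  assumes "conv \<Lambda> A A'" "closed_at 1 b" "names b \<subseteq> syms \<Lambda> \<union> vars \<Lambda>"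
  shows "conv \<Lambda> (PiT A b) (PiT A' b)"
  using assms(1)
proof (rule conv_map[rotated])
  fix t u assume r: "red \<Lambda> t u"
  then have "is_trm \<Lambda> (PiT t b)" using assms red_is_trm by (auto simp: is_trm_LamT is_trm_PiT)
  with r show "conv \<Lambda> (PiT t b) (PiT u b)"
    by (auto elim!: red_cases intro!: red_conv intro: redI ctxt_closure.pi_dom)
qed

text \<open>The terms met between the two opened bodies may mention \<open>z\<close>, so each of
  them is closed again by \<open>bind 0 z\<close>. This also makes \<open>z\<close> fresh for the
  results, as \<open>lam_body\<close> requires.\<close>

lemma conv_LamT_body:
  assumes "conv \<Lambda> (inst 0 (Nm z) b) (inst 0 (Nm z) b')" "is_trm \<Lambda> A"
    "z \<in> vars \<Lambda>" "z \<notin> names b" "z \<notin> names b'"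
  shows "conv \<Lambda> (LamT A b) (LamT A b')"
proof -
  have "conv \<Lambda> (LamT A (bind 0 z (inst 0 (Nm z) b))) (LamT A (bind 0 z (inst 0 (Nm z) b')))"
    using assms(1)
  proof (rule conv_map[where h = "\<lambda>t. LamT A (bind 0 z t)", rotated])
    fix t u assume r: "red \<Lambda> t u"
    then obtain P where P: "P = rule_instance \<Lambda> \<or> P = beta_redex \<Lambda>" "ctxt_closure \<Lambda> P t u"
      by (elim red_cases)
    have "closed_at 0 t" "closed_at 0 u" using red_is_trm[OF r] by (auto simp: is_trm_def)
    then have "ctxt_closure \<Lambda> P (LamT A (bind 0 z t)) (LamT A (bind 0 z u))"
      using P(2) assms by (intro ctxt_closure.lam_body[of _ _ z]) (auto simp: inst_bind)
    then show "conv \<Lambda> (LamT A (bind 0 z t)) (LamT A (bind 0 z u))"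
      using P(1) by (blast intro: red_conv redI)
  qed
  then show ?thesis using assms by (simp add: bind_inst)
qed

lemma conv_PiT_cod:
  assumes "conv \<Lambda> (inst 0 (Nm z) b) (inst 0 (Nm z) b')" "is_trm \<Lambda> A"
    "z \<in> vars \<Lambda>" "z \<notin> names b" "z \<notin> names b'"
  shows "conv \<Lambda> (PiT A b) (PiT A b')"
proof -
  have "conv \<Lambda> (PiT A (bind 0 z (inst 0 (Nm z) b))) (PiT A (bind 0 z (inst 0 (Nm z) b')))"
    using assms(1)
  proof (rule conv_map[where h = "\<lambda>t. PiT A (bind 0 z t)", rotated])
    fix t u assume r: "red \<Lambda> t u"
    then obtain P where P: "P = rule_instance \<Lambda> \<or> P = beta_redex \<Lambda>" "ctxt_closure \<Lambda> P t u"
      by (elim red_cases)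
    have "closed_at 0 t" "closed_at 0 u" using red_is_trm[OF r] by (auto simp: is_trm_def)
    then have "ctxt_closure \<Lambda> P (PiT A (bind 0 z t)) (PiT A (bind 0 z u))"
      using P(2) assms by (intro ctxt_closure.pi_cod[of _ _ z]) (auto simp: inst_bind)
    then show "conv \<Lambda> (PiT A (bind 0 z t)) (PiT A (bind 0 z u))"
      using P(1) by (blast intro: red_conv redI)
  qed
  then show ?thesis using assms by (simp add: bind_inst)
qed

end

section \<open>Environments\<close>

text \<open>There is no separate judgement for well-formed environments: (ax) and (weak) type
  \<open>Star\<close> by \<open>Box\<close> in precisely those that declare distinct variables with
  typable types.\<close>

abbreviation valid_env :: "'a calc \<Rightarrow> 'a env \<Rightarrow> bool" where
  "valid_env \<Lambda> \<Gamma> \<equiv> typing \<Lambda> \<Gamma> (Srt Star) (Srt Box)"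

lemma typing_valid_env: "typing \<Lambda> \<Gamma> t T \<Longrightarrow> valid_env \<Lambda> \<Gamma>"
proof (induction rule: typing.induct)
  case (ty_var \<Gamma> A s x)
  then show ?case by (metis ty_weak)
next
  case (ty_weak \<Gamma> t T A s x)
  then show ?case by (metis typing.ty_weak)
qed (auto intro: ty_ax)

text \<open>Only (var) and (weak) extend an environment; any other rule has the empty environment or
  shares its environment with a premise.\<close>

lemma typing_Cons_env:
  assumes "typing \<Lambda> ((x, A) # \<Gamma>) t T"
  shows "x \<in> vars \<Lambda> \<and> x \<notin> fst ` set \<Gamma> \<and> (\<exists>s. typing \<Lambda> \<Gamma> A (Srt s))"
  using assms by (induction "(x, A) # \<Gamma>" t T rule: typing.induct) auto

lemma typing_names: "typing \<Lambda> \<Gamma> t T \<Longrightarrow> names t \<union> names T \<subseteq> syms \<Lambda> \<union> fst ` set \<Gamma>"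
proof (induction rule: typing.induct)
  case (ty_prod \<Gamma> A x B s)
  then show ?case using names_inst_ge[of B 0 "Nm x"] by auto
next
  case (ty_app \<Gamma> t A B a)
  then show ?case using names_inst[of 0 a B] by auto
next
  case (ty_abs x b B A \<Gamma> s)
  then show ?case using names_inst_ge[of b 0 "Nm x"] by auto
qed auto

lemma typing_weaken_Nil: "typing \<Lambda> [] t T \<Longrightarrow> valid_env \<Lambda> \<Gamma> \<Longrightarrow> typing \<Lambda> \<Gamma> t T"
proof (induction \<Gamma>)
  case (Cons p \<Gamma>)
  obtain x A where p: "p = (x, A)" by (cases p)
  from typing_Cons_env[OF Cons.prems(2)[unfolded p]] obtain s
    where "x \<in> vars \<Lambda>" "x \<notin> fst ` set \<Gamma>" "typing \<Lambda> \<Gamma> A (Srt s)" by blast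
  then show ?case using Cons p typing_valid_env ty_weak by metis
qed

lemma valid_env_lookup: "valid_env \<Lambda> \<Gamma> \<Longrightarrow> (x, A) \<in> set \<Gamma> \<Longrightarrow> typing \<Lambda> \<Gamma> (Nm x) A"
proof (induction \<Gamma>)
  case (Cons p \<Gamma>)
  obtain y B where p: "p = (y, B)" by (cases p)
  from typing_Cons_env[OF Cons.prems(1)[unfolded p]] obtain s
    where "y \<in> vars \<Lambda>" "y \<notin> fst ` set \<Gamma>" "typing \<Lambda> \<Gamma> B (Srt s)" by blast
  then show ?case using Cons p typing_valid_env ty_weak ty_var
    by (metis Pair_inject set_ConsD)
qed simp

lemma valid_env_distinct: "valid_env \<Lambda> \<Gamma> \<Longrightarrow> distinct (map fst \<Gamma>)"
proof (induction \<Gamma>)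
  case (Cons p \<Gamma>)
  then show ?case
    using typing_Cons_env[of \<Lambda> "fst p" "snd p" \<Gamma>] typing_valid_env[of \<Lambda> \<Gamma> "snd p"] by auto
qed simp

lemma valid_env_vars: "valid_env \<Lambda> \<Gamma> \<Longrightarrow> fst ` set \<Gamma> \<subseteq> vars \<Lambda>"
proof (induction \<Gamma>)
  case (Cons p \<Gamma>)
  then show ?case
    using typing_Cons_env[of \<Lambda> "fst p" "snd p" \<Gamma>] typing_valid_env[of \<Lambda> \<Gamma> "snd p"] by auto
qed simp

text \<open>Every typing of a product goes back to (prod), whose premise fixes the sort of the
  domain; (weak) and (conv) preserve it.\<close>

lemma PiT_dom_typed: "typing \<Lambda> \<Gamma> (PiT A B) T \<Longrightarrow> typing \<Lambda> \<Gamma> A (Srt Star)"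
  by (induction \<Gamma> "PiT A B" T rule: typing.induct) (assumption | metis ty_weak)+

section \<open>Translations between calculi\<close>

text \<open>
  A family \<open>G\<close> of maps from the names of \<open>\<Lambda>'\<close> to terms of \<open>\<Lambda>\<close> that is closed under renaming of
  a variable. The case \<open>\<Lambda>' = \<Lambda>\<close> gives the usual substitution and weakening lemmas.
\<close>

locale translation = calculus \<Lambda> for \<Lambda> :: "'a calc" +
  fixes \<Lambda>' :: "'a calc" and G :: "('a \<Rightarrow> 'a trm) \<Rightarrow> bool"
  assumes G_closed: "\<And>\<theta> a. G \<theta> \<Longrightarrow> closed_at 0 (\<theta> a)"
    and G_trm: "\<And>\<theta> a. G \<theta> \<Longrightarrow> a \<in> syms \<Lambda>' \<union> vars \<Lambda>' \<Longrightarrow> is_trm \<Lambda> (\<theta> a)"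
    and G_upd: "\<And>\<theta> x z. G \<theta> \<Longrightarrow> x \<in> vars \<Lambda>' \<Longrightarrow> z \<in> vars \<Lambda> \<Longrightarrow> G (\<theta>(x := Nm z))"
    and G_rule: "\<And>\<theta> t u. G \<theta> \<Longrightarrow> rule_instance \<Lambda>' t u \<Longrightarrow> conv \<Lambda> (t \<cdot> \<theta>) (u \<cdot> \<theta>)"
    and disj': "syms \<Lambda>' \<inter> vars \<Lambda>' = {}"
    and types': "\<And>f. f \<in> syms \<Lambda>' \<Longrightarrow> names (type_of \<Lambda>' f) \<subseteq> syms \<Lambda>'"
begin

lemma is_trm_translate: "G \<theta> \<Longrightarrow> is_trm \<Lambda>' t \<Longrightarrow> is_trm \<Lambda> (t \<cdot> \<theta>)"
  using is_trm_subst G_closed G_trm by metis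

lemma inst_translate:
  "G \<theta> \<Longrightarrow> x \<notin> names t \<Longrightarrow> inst 0 (Nm x) t \<cdot> \<theta>(x := Nm z) = inst 0 (Nm z) (t \<cdot> \<theta>)"
  by (rule inst_Nm_subst) (auto intro: G_closed)

text \<open>The result is a conversion rather than a reduction step because a rule of
  \<open>\<Lambda>'\<close> may be an equation that holds only up to conversion after translation.
  \<open>\<theta>\<close> is generalised since it changes at each binder.\<close>

lemma ctxt_closure_translate:
  assumes "ctxt_closure \<Lambda>' P t u" "P = rule_instance \<Lambda>' \<or> P = beta_redex \<Lambda>'" "G \<theta>"
  shows "conv \<Lambda> (t \<cdot> \<theta>) (u \<cdot> \<theta>)"
  using assms(1,3)
proof (induction arbitrary: \<theta> rule: ctxt_closure.induct)
  case (root t u)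
  show ?case using assms(2)
  proof
    assume "P = rule_instance \<Lambda>'"
    then show ?thesis using root G_rule by simp
  next
    assume "P = beta_redex \<Lambda>'"
    then obtain A b a where *: "is_trm \<Lambda>' t" "t = AppT (LamT A b) a" "u = inst 0 a b"
      using root by (auto simp: beta_redex_def)
    have "u \<cdot> \<theta> = inst 0 (a \<cdot> \<theta>) (b \<cdot> \<theta>)" using * root.prems G_closed by (simp add: inst_subst)
    moreover have "is_trm \<Lambda> (t \<cdot> \<theta>)" using * root.prems is_trm_translate by blast
    ultimately have "beta_redex \<Lambda> (t \<cdot> \<theta>) (u \<cdot> \<theta>)" using * by (auto simp: beta_redex_def)
    then show ?thesis by (blast intro: red_conv redI ctxt_closure.root)
  qed
next
  case (lam_dom A A' b)
  have "is_trm \<Lambda> (LamT A b \<cdot> \<theta>)" using lam_dom is_trm_translate by blast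
  then show ?case using lam_dom by (auto simp: is_trm_LamT intro!: conv_LamT_dom)
next
  case (pi_dom A A' b)
  have "is_trm \<Lambda> (PiT A b \<cdot> \<theta>)" using pi_dom is_trm_translate by blast
  then show ?case using pi_dom by (auto simp: is_trm_PiT is_trm_LamT intro!: conv_PiT_dom)
next
  case (app_fun t t' u)
  then show ?case using is_trm_translate by (auto intro!: conv_AppT_left)
next
  case (app_arg t u u')
  then show ?case using is_trm_translate by (auto intro!: conv_AppT_right)
next
  case (lam_body A x b b')
  \<comment> \<open>The name \<open>x\<close> that opens the bodies may occur in images of
    \<open>\<theta>\<close>, so it is sent to a variable fresh for the translated bodies.\<close>
  obtain z where z: "z \<in> vars \<Lambda>" "z \<notin> names (b \<cdot> \<theta>) \<union> names (b' \<cdot> \<theta>)"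
    using fresh[of "names (b \<cdot> \<theta>) \<union> names (b' \<cdot> \<theta>)"] by auto
  have "conv \<Lambda> (inst 0 (Nm z) (b \<cdot> \<theta>)) (inst 0 (Nm z) (b' \<cdot> \<theta>))"
    using lam_body.IH[of "\<theta>(x := Nm z)"] lam_body.hyps lam_body.prems z
    by (auto simp: inst_translate G_upd simp del: fun_upd_apply)
  then show ?case using z lam_body is_trm_translate by (auto intro!: conv_LamT_body[of z])
next
  case (pi_cod A x b b')
  obtain z where z: "z \<in> vars \<Lambda>" "z \<notin> names (b \<cdot> \<theta>) \<union> names (b' \<cdot> \<theta>)"
    using fresh[of "names (b \<cdot> \<theta>) \<union> names (b' \<cdot> \<theta>)"] by auto
  have "conv \<Lambda> (inst 0 (Nm z) (b \<cdot> \<theta>)) (inst 0 (Nm z) (b' \<cdot> \<theta>))"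
    using pi_cod.IH[of "\<theta>(x := Nm z)"] pi_cod.hyps pi_cod.prems z
    by (auto simp: inst_translate G_upd simp del: fun_upd_apply)
  then show ?case using z pi_cod is_trm_translate by (auto intro!: conv_PiT_cod[of z])
qed

lemma conv_translate: "G \<theta> \<Longrightarrow> conv \<Lambda>' t u \<Longrightarrow> conv \<Lambda> (t \<cdot> \<theta>) (u \<cdot> \<theta>)"
  by (rule conv_map[of \<Lambda>']) (auto elim!: red_cases intro: ctxt_closure_translate)

text \<open>Symbols are treated like declared variables: a symbol of \<open>\<Lambda>'\<close> may
  be sent to an arbitrary term, which must have the translated type.\<close>

definition well_typed_map :: "'a env \<Rightarrow> ('a \<Rightarrow> 'a trm) \<Rightarrow> 'a env \<Rightarrow> bool" where
  "well_typed_map \<Gamma> \<theta> \<Delta> \<longleftrightarrow> G \<theta> \<and> valid_env \<Lambda> \<Gamma> \<and>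
     (\<forall>f \<in> syms \<Lambda>'. typing \<Lambda> \<Gamma> (\<theta> f) (type_of \<Lambda>' f \<cdot> \<theta>)) \<and>
     (\<forall>(x, A) \<in> set \<Delta>. typing \<Lambda> \<Gamma> (\<theta> x) (A \<cdot> \<theta>))"

text \<open>Used to pass under a binder. \<open>x\<close> occurs neither in the types declared in
  \<open>\<Delta>\<close> nor in those of symbols, so the update leaves their translations alone,
  and (weak) with the fresh \<open>z\<close> carries the old typings over.\<close>

lemma well_typed_map_Cons:
  assumes r: "well_typed_map \<Gamma> \<theta> \<Delta>" and v: "typing \<Lambda>' ((x, A) # \<Delta>) t T"
    and z: "z \<in> vars \<Lambda>" "z \<notin> fst ` set \<Gamma>" and A: "typing \<Lambda> \<Gamma> (A \<cdot> \<theta>) (Srt s)"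
  shows "well_typed_map ((z, A \<cdot> \<theta>) # \<Gamma>) (\<theta>(x := Nm z)) ((x, A) # \<Delta>)"
proof -
  let ?\<theta> = "\<theta>(x := Nm z)" and ?\<Gamma> = "(z, A \<cdot> \<theta>) # \<Gamma>"
  from typing_Cons_env[OF v] obtain s' where
    x: "x \<in> vars \<Lambda>'" "x \<notin> fst ` set \<Delta>" and A': "typing \<Lambda>' \<Delta> A (Srt s')" by blast
  then have xs: "x \<notin> syms \<Lambda>'" using disj' by blast
  have eq: "B \<cdot> ?\<theta> = B \<cdot> \<theta>" if "x \<notin> names B" for B
    using that by (intro subst_cong) auto
  have wk: "typing \<Lambda> ?\<Gamma> t T" if "typing \<Lambda> \<Gamma> t T" for t T
    using that A z by (rule ty_weak)
  have \<Delta>: "x \<notin> names B" if "(y, B) \<in> set \<Delta>" for y B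
    using typing_names[OF valid_env_lookup[OF typing_valid_env[OF A'] that]] x(2) xs by blast
  have A_x: "x \<notin> names A" using typing_names[OF A'] x(2) xs by blast
  show ?thesis unfolding well_typed_map_def
  proof (intro conjI ballI)
    show "G ?\<theta>" using r x z by (auto simp: well_typed_map_def G_upd)
    show "valid_env \<Lambda> ?\<Gamma>" using r wk by (auto simp: well_typed_map_def)
    show "typing \<Lambda> ?\<Gamma> (?\<theta> f) (type_of \<Lambda>' f \<cdot> ?\<theta>)" if f: "f \<in> syms \<Lambda>'" for f
    proof -
      have "f \<noteq> x" "x \<notin> names (type_of \<Lambda>' f)" using f xs types' by auto
      then show ?thesis using r f by (auto simp: well_typed_map_def eq intro!: wk)
    qed
    show "case p of (y, B) \<Rightarrow> typing \<Lambda> ?\<Gamma> (?\<theta> y) (B \<cdot> ?\<theta>)" if p: "p \<in> set ((x, A) # \<Delta>)" for p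
    proof (cases "p = (x, A)")
      case True
      then show ?thesis using A_x ty_var[OF A z] by (simp add: eq)
    next
      case False
      then obtain y B where yB: "p = (y, B)" "(y, B) \<in> set \<Delta>" using p by (cases p) auto
      then have "y \<noteq> x" using x(2) by force
      then show ?thesis using yB r \<Delta>[OF yB(2)] by (auto simp: well_typed_map_def eq intro!: wk)
    qed
  qed
qed

text \<open>Induction on the derivation: (fun) and (var) are the two typing clauses of
  \<open>well_typed_map\<close>, (conv) is \<open>conv_translate\<close>, and binders go through
  \<open>well_typed_map_Cons\<close>.\<close>

lemma typing_translate:
  "typing \<Lambda>' \<Delta> t T \<Longrightarrow> well_typed_map \<Gamma> \<theta> \<Delta> \<Longrightarrow> typing \<Lambda> \<Gamma> (t \<cdot> \<theta>) (T \<cdot> \<theta>)"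
proof (induction arbitrary: \<Gamma> \<theta> rule: typing.induct)
  case ty_ax
  then show ?case by (simp add: well_typed_map_def)
next
  case (ty_fun f)
  then show ?case by (simp add: well_typed_map_def)
next
  case (ty_var \<Delta> A s x)
  then show ?case by (simp add: well_typed_map_def)
next
  case (ty_weak \<Delta> t T A s x)
  then show ?case by (simp add: well_typed_map_def)
next
  case (ty_prod \<Delta> A x B s)
  have A: "typing \<Lambda> \<Gamma> (A \<cdot> \<theta>) (Srt Star)" using ty_prod.IH(1)[OF ty_prod.prems] by simp
  \<comment> \<open>\<open>x\<close> may already be declared in \<open>\<Gamma>\<close>, so the
    translated codomain is opened at a fresh \<open>z\<close>.\<close>
  obtain z where z: "z \<in> vars \<Lambda>" "z \<notin> fst ` set \<Gamma> \<union> names (B \<cdot> \<theta>)"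
    using fresh[of "fst ` set \<Gamma> \<union> names (B \<cdot> \<theta>)"] by auto
  have G: "G \<theta>" using ty_prod.prems by (simp add: well_typed_map_def)
  have "well_typed_map ((z, A \<cdot> \<theta>) # \<Gamma>) (\<theta>(x := Nm z)) ((x, A) # \<Delta>)"
    using well_typed_map_Cons[OF ty_prod.prems ty_prod.hyps(3)] A z by auto
  from ty_prod.IH(2)[OF this]
  have "typing \<Lambda> ((z, A \<cdot> \<theta>) # \<Gamma>) (inst 0 (Nm z) (B \<cdot> \<theta>)) (Srt s)"
    using ty_prod.hyps G by (simp add: inst_translate del: fun_upd_apply)
  then show ?case using A z typing.ty_prod[of \<Lambda> \<Gamma> "A \<cdot> \<theta>" z "B \<cdot> \<theta>"] by auto
next
  case (ty_app \<Delta> t A B a)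
  have "inst 0 a B \<cdot> \<theta> = inst 0 (a \<cdot> \<theta>) (B \<cdot> \<theta>)"
    using ty_app.prems G_closed by (intro inst_subst) (auto simp: well_typed_map_def)
  then show ?case using ty_app.IH[OF ty_app.prems] by (auto intro: typing.ty_app)
next
  case (ty_abs x b B A \<Delta> s)
  have P: "typing \<Lambda> \<Gamma> (PiT (A \<cdot> \<theta>) (B \<cdot> \<theta>)) (Srt s)" using ty_abs.IH(2)[OF ty_abs.prems] by simp
  \<comment> \<open>(abs) has no premise for the domain alone; the translated domain is typed by way
    of the product.\<close>
  note A = PiT_dom_typed[OF this]
  obtain z where z: "z \<in> vars \<Lambda>" "z \<notin> fst ` set \<Gamma> \<union> names (B \<cdot> \<theta>) \<union> names (b \<cdot> \<theta>)"
    using fresh[of "fst ` set \<Gamma> \<union> names (B \<cdot> \<theta>) \<union> names (b \<cdot> \<theta>)"] by auto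
  have G: "G \<theta>" using ty_abs.prems by (simp add: well_typed_map_def)
  have "well_typed_map ((z, A \<cdot> \<theta>) # \<Gamma>) (\<theta>(x := Nm z)) ((x, A) # \<Delta>)"
    using well_typed_map_Cons[OF ty_abs.prems ty_abs.hyps(2)] A z by auto
  from ty_abs.IH(1)[OF this]
  have "typing \<Lambda> ((z, A \<cdot> \<theta>) # \<Gamma>) (inst 0 (Nm z) (b \<cdot> \<theta>)) (inst 0 (Nm z) (B \<cdot> \<theta>))"
    using ty_abs.hyps G by (simp add: inst_translate del: fun_upd_apply)
  then show ?case using P z typing.ty_abs[of z "b \<cdot> \<theta>" "B \<cdot> \<theta>" \<Lambda> "A \<cdot> \<theta>" \<Gamma>] by auto
next
  case (ty_conv \<Delta> t T U s)
  have "conv \<Lambda> (T \<cdot> \<theta>) (U \<cdot> \<theta>)"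
    using ty_conv conv_translate by (auto simp: well_typed_map_def)
  then show ?case using ty_conv.IH[OF ty_conv.prems] by (auto intro: typing.ty_conv)
qed

end

section \<open>Generation and uniqueness of types\<close>

lemma typing_closed: "typing \<Lambda> \<Gamma> t T \<Longrightarrow> closed_at 0 t \<and> closed_at 0 T"
proof (induction rule: typing.induct)
  case (ty_prod \<Gamma> A x B s)
  then show ?case using closed_at_instD[of 0 "Nm x" B] by simp
next
  case (ty_app \<Gamma> t A B a)
  then show ?case using closed_at_inst[of 0 B a] by simp
next
  case (ty_abs x b B A \<Gamma> s)
  then show ?case using closed_at_instD[of 0 "Nm x" b] by simp
qed auto

lemma typing_is_trm:
  assumes "typing \<Lambda> \<Gamma> t T"
  shows "is_trm \<Lambda> t" "is_trm \<Lambda> T"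
  using typing_closed[OF assms] typing_names[OF assms] valid_env_vars[OF typing_valid_env[OF assms]]
  unfolding is_trm_def by blast+

text \<open>\<open>confl\<close> and \<open>heads\<close> together yield injectivity of products:
  \<open>heads\<close> excludes rewriting a product at the root.\<close>

locale typed_calculus = calculus +
  assumes types: "\<And>f. f \<in> syms \<Lambda> \<Longrightarrow> typing \<Lambda> [] (type_of \<Lambda> f) (Srt (sort_of \<Lambda> f))"
    and confl: "confluentp (red \<Lambda>)"
    and heads: "\<And>g d. (g, d) \<in> rules \<Lambda> \<Longrightarrow> \<exists>f ts. f \<in> syms \<Lambda> \<and> g = apps (Nm f) ts"
begin

section \<open>Substitution and weakening within one calculus\<close>

lemma names_type_of: "f \<in> syms \<Lambda> \<Longrightarrow> names (type_of \<Lambda> f) \<subseteq> syms \<Lambda>"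
  using typing_names[OF types] by auto

lemma subst_fixes: "is_sub \<Lambda> \<sigma> \<Longrightarrow> names t \<subseteq> syms \<Lambda> \<Longrightarrow> t \<cdot> \<sigma> = t"
  using subst_cong[of t \<sigma> Nm] is_sub_fixes[of \<Lambda> \<sigma>] disj by (metis disjoint_iff subsetD subst_Nm)

lemma is_sub_comp:
  assumes "is_sub \<Lambda> \<sigma>" "is_sub \<Lambda> \<tau>"
  shows "is_sub \<Lambda> (\<lambda>a. \<sigma> a \<cdot> \<tau>)"
proof -
  have "{a. \<sigma> a \<cdot> \<tau> \<noteq> Nm a} \<subseteq> {a. \<sigma> a \<noteq> Nm a} \<union> {a. \<tau> a \<noteq> Nm a}" by auto
  then show ?thesis using assms is_sub_is_trm[OF assms(2)] unfolding is_sub_def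
    by (auto intro: finite_subset)
qed

lemma rule_instance_subst:
  assumes "rule_instance \<Lambda> t u" "is_sub \<Lambda> \<theta>"
  shows "rule_instance \<Lambda> (t \<cdot> \<theta>) (u \<cdot> \<theta>)"
  using assms is_sub_comp unfolding rule_instance_def by (metis subst_subst)

lemma rule_instance_conv: "rule_instance \<Lambda> t u \<Longrightarrow> conv \<Lambda> t u"
  by (blast intro: red_conv redI ctxt_closure.root)

sublocale self: translation \<Lambda> \<Lambda> "is_sub \<Lambda>"
  by unfold_locales
    (use disj names_type_of in \<open>auto intro: is_sub_closed is_sub_trm is_sub_upd
       rule_instance_conv rule_instance_subst\<close>)

lemmas conv_subst = self.conv_translate

text \<open>Substitution and weakening at once, as the translation along \<open>Nm(x := a)\<close>.
  Inclusion of the declarations suffices, since \<open>valid_env_lookup\<close> types each of them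
  in any valid environment that contains it.\<close>

lemma typing_inst:
  assumes t: "typing \<Lambda> ((x, A) # \<Delta>) (inst 0 (Nm x) b) (inst 0 (Nm x) B)"
    and x: "x \<notin> names b" "x \<notin> names B"
    and \<Gamma>: "set \<Delta> \<subseteq> set \<Gamma>" and a: "typing \<Lambda> \<Gamma> a A"
  shows "typing \<Lambda> \<Gamma> (inst 0 a b) (inst 0 a B)"
proof -
  let ?\<theta> = "Nm(x := a)"
  from typing_Cons_env[OF t] obtain s where
    xv: "x \<in> vars \<Lambda>" "x \<notin> fst ` set \<Delta>" and A: "typing \<Lambda> \<Delta> A (Srt s)" by blast
  have xs: "x \<notin> syms \<Lambda>" using xv disj by blast
  have eq: "C \<cdot> ?\<theta> = C" if "x \<notin> names C" for C
    using that subst_cong[of C ?\<theta> Nm] by (metis fun_upd_other subst_Nm)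
  have sub: "is_sub \<Lambda> ?\<theta>" using xv typing_is_trm[OF a] by (intro is_sub_upd) auto
  have v: "valid_env \<Lambda> \<Gamma>" using a by (rule typing_valid_env)
  have "self.well_typed_map \<Gamma> ?\<theta> ((x, A) # \<Delta>)" unfolding self.well_typed_map_def
  proof (intro conjI ballI)
    show "typing \<Lambda> \<Gamma> (?\<theta> f) (type_of \<Lambda> f \<cdot> ?\<theta>)" if f: "f \<in> syms \<Lambda>" for f
    proof -
      have "f \<noteq> x" using f xs by auto
      moreover have "type_of \<Lambda> f \<cdot> ?\<theta> = type_of \<Lambda> f" using f xs names_type_of by (intro eq) auto
      ultimately show ?thesis using f types v by (auto intro: typing_weaken_Nil ty_fun)
    qed
    show "case p of (y, C) \<Rightarrow> typing \<Lambda> \<Gamma> (?\<theta> y) (C \<cdot> ?\<theta>)" if p: "p \<in> set ((x, A) # \<Delta>)" for p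
    proof (cases "p = (x, A)")
      case True
      have "x \<notin> names A" using typing_names[OF A] xv xs by blast
      then show ?thesis using True a by (simp add: eq)
    next
      case False
      then obtain y C where yC: "p = (y, C)" "(y, C) \<in> set \<Delta>" using p by (cases p) auto
      then have "y \<noteq> x" using xv by force
      moreover have "x \<notin> names C"
        using typing_names[OF valid_env_lookup[OF typing_valid_env[OF A] yC(2)]] xv xs by blast
      ultimately show ?thesis using yC \<Gamma> v by (auto simp: eq intro!: valid_env_lookup)
    qed
  qed (use sub v in auto)
  from self.typing_translate[OF t this] show ?thesis
    using inst_Nm_subst[of Nm a x b 0] inst_Nm_subst[of Nm a x B 0] x typing_closed[OF a] by simp
qed

text \<open>The case of \<open>typing_inst\<close> where \<open>a\<close> is a new variable: a
  derivation opened at one bound name yields one at any other fresh name.\<close>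

lemma typing_weaken_binder:
  assumes t: "typing \<Lambda> ((x, A) # \<Delta>) (inst 0 (Nm x) b) (inst 0 (Nm x) B)"
    and x: "x \<notin> names b" "x \<notin> names B"
    and \<Gamma>: "set \<Delta> \<subseteq> set \<Gamma>" and A: "typing \<Lambda> \<Gamma> A (Srt s)"
    and z: "z \<in> vars \<Lambda>" "z \<notin> fst ` set \<Gamma>"
  shows "typing \<Lambda> ((z, A) # \<Gamma>) (inst 0 (Nm z) b) (inst 0 (Nm z) B)"
  using \<Gamma> A z by (intro typing_inst[OF t x]) (auto intro: ty_var)

section \<open>Generation lemmas\<close>

lemma Srt_typed: "typing \<Lambda> \<Gamma> (Srt s) T \<Longrightarrow> s = Star \<and> conv \<Lambda> (Srt Box) T"
  by (induction \<Gamma> "Srt s :: 'a trm" T rule: typing.induct) (auto dest: conv_trans)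

lemma Nm_sym_typed: "typing \<Lambda> \<Gamma> (Nm f) T \<Longrightarrow> f \<in> syms \<Lambda> \<Longrightarrow> conv \<Lambda> (type_of \<Lambda> f) T"
  by (induction \<Gamma> "Nm f" T rule: typing.induct) (use disj in \<open>auto intro: conv_trans\<close>)

lemma Nm_var_typed:
  "typing \<Lambda> \<Gamma> (Nm x) T \<Longrightarrow> x \<in> vars \<Lambda> \<Longrightarrow> \<exists>A. (x, A) \<in> set \<Gamma> \<and> conv \<Lambda> A T"
  by (induction \<Gamma> "Nm x" T rule: typing.induct) (use disj in \<open>auto intro: conv_trans\<close>)

text \<open>(prod) opens the codomain at a single name. All fresh names are covered here, as in
  \<open>LamT_typed\<close>, so that two derivations for the same term can later be compared at a
  common name.\<close>

lemma PiT_typed: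
  "typing \<Lambda> \<Gamma> (PiT A B) T \<Longrightarrow> \<exists>s. conv \<Lambda> (Srt s) T \<and>
     (\<forall>z. z \<in> vars \<Lambda> \<and> z \<notin> fst ` set \<Gamma> \<longrightarrow> z \<notin> names B \<longrightarrow>
        typing \<Lambda> ((z, A) # \<Gamma>) (inst 0 (Nm z) B) (Srt s))"
proof (induction \<Gamma> "PiT A B" T rule: typing.induct)
  case (ty_weak \<Gamma> T C s' y)
  then obtain s where s: "conv \<Lambda> (Srt s) T" and
    IH: "\<And>z. z \<in> vars \<Lambda> \<and> z \<notin> fst ` set \<Gamma> \<Longrightarrow> z \<notin> names B \<Longrightarrow>
      typing \<Lambda> ((z, A) # \<Gamma>) (inst 0 (Nm z) B) (Srt s)" by blast
  have "typing \<Lambda> ((y, C) # \<Gamma>) A (Srt Star)"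
    using PiT_dom_typed[OF ty_weak.hyps(1)] ty_weak.hyps by (metis typing.ty_weak)
  \<comment> \<open>Renaming \<open>z\<close> to itself, \<open>typing_weaken_binder\<close> inserts
    the new declaration below the bound variable.\<close>
  then have "typing \<Lambda> ((z, A) # (y, C) # \<Gamma>) (inst 0 (Nm z) B) (Srt s)"
    if "z \<in> vars \<Lambda> \<and> z \<notin> fst ` set ((y, C) # \<Gamma>)" "z \<notin> names B" for z
    using typing_weaken_binder[of z A \<Gamma> B "Srt s" "(y, C) # \<Gamma>" Star z] IH[of z] that by auto
  with s show ?case by blast
next
  case (ty_prod \<Gamma> x s)
  then have "typing \<Lambda> ((z, A) # \<Gamma>) (inst 0 (Nm z) B) (Srt s)"
    if "z \<in> vars \<Lambda> \<and> z \<notin> fst ` set \<Gamma>" for z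
    using typing_weaken_binder[of x A \<Gamma> B "Srt s" \<Gamma> Star z] that by auto
  then show ?case by blast
next
  case (ty_conv \<Gamma> T U s)
  then show ?case by (meson conv_trans)
qed

lemma LamT_typed:
  "typing \<Lambda> \<Gamma> (LamT A b) T \<Longrightarrow> \<exists>B s. conv \<Lambda> (PiT A B) T \<and> typing \<Lambda> \<Gamma> (PiT A B) (Srt s) \<and>
     (\<forall>z. z \<in> vars \<Lambda> \<and> z \<notin> fst ` set \<Gamma> \<longrightarrow> z \<notin> names b \<longrightarrow> z \<notin> names B \<longrightarrow>
        typing \<Lambda> ((z, A) # \<Gamma>) (inst 0 (Nm z) b) (inst 0 (Nm z) B))"
proof (induction \<Gamma> "LamT A b" T rule: typing.induct)
  case (ty_weak \<Gamma> T C s' y)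
  then obtain B s where B: "conv \<Lambda> (PiT A B) T" "typing \<Lambda> \<Gamma> (PiT A B) (Srt s)" and
    IH: "\<And>z. z \<in> vars \<Lambda> \<and> z \<notin> fst ` set \<Gamma> \<Longrightarrow> z \<notin> names b \<Longrightarrow> z \<notin> names B \<Longrightarrow>
      typing \<Lambda> ((z, A) # \<Gamma>) (inst 0 (Nm z) b) (inst 0 (Nm z) B)" by blast
  have P: "typing \<Lambda> ((y, C) # \<Gamma>) (PiT A B) (Srt s)"
    using B(2) ty_weak.hyps by (metis typing.ty_weak)
  have "typing \<Lambda> ((z, A) # (y, C) # \<Gamma>) (inst 0 (Nm z) b) (inst 0 (Nm z) B)"
    if "z \<in> vars \<Lambda> \<and> z \<notin> fst ` set ((y, C) # \<Gamma>)" "z \<notin> names b" "z \<notin> names B" for z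
    using typing_weaken_binder[of z A \<Gamma> b B "(y, C) # \<Gamma>" Star z] IH[of z] that
      PiT_dom_typed[OF P] by auto
  with B P show ?case by blast
next
  case (ty_abs x B \<Gamma> s)
  have "typing \<Lambda> \<Gamma> A (Srt Star)" using ty_abs PiT_dom_typed by blast
  with ty_abs have "typing \<Lambda> ((z, A) # \<Gamma>) (inst 0 (Nm z) b) (inst 0 (Nm z) B)"
    if "z \<in> vars \<Lambda> \<and> z \<notin> fst ` set \<Gamma>" for z
    using typing_weaken_binder[of x A \<Gamma> b B \<Gamma> Star z] that by auto
  with ty_abs show ?case by blast
next
  case (ty_conv \<Gamma> T U s)
  then show ?case by (meson conv_trans)
qed

lemma AppT_typed:
  "typing \<Lambda> \<Gamma> (AppT t a) T \<Longrightarrow>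
     \<exists>A B. typing \<Lambda> \<Gamma> t (PiT A B) \<and> typing \<Lambda> \<Gamma> a A \<and> conv \<Lambda> (inst 0 a B) T"
proof (induction \<Gamma> "AppT t a" T rule: typing.induct)
  case (ty_weak \<Gamma> T C s y)
  then show ?case by (meson typing.ty_weak)
next
  case (ty_conv \<Gamma> T U s)
  then show ?case by (meson conv_trans)
qed auto

lemma PiT_cod_typed:
  assumes "typing \<Lambda> \<Gamma> (PiT A B) T" "typing \<Lambda> \<Gamma> a A"
  shows "\<exists>s. typing \<Lambda> \<Gamma> (inst 0 a B) (Srt s)"
proof -
  obtain z where z: "z \<in> vars \<Lambda>" "z \<notin> fst ` set \<Gamma> \<union> names B"
    using fresh[of "fst ` set \<Gamma> \<union> names B"] by auto
  then obtain s where "typing \<Lambda> ((z, A) # \<Gamma>) (inst 0 (Nm z) B) (Srt s)"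
    using PiT_typed[OF assms(1)] by auto
  then show ?thesis using typing_inst[of z A \<Gamma> B "Srt s" \<Gamma> a] z assms by auto
qed

text \<open>A type is a sort given by (ax) or (prod), or a premise types it; in (app) it is an
  instance of the codomain of a typable product. \<open>Box\<close> is the exception because it has
  no type itself.\<close>

lemma type_correctness: "typing \<Lambda> \<Gamma> t T \<Longrightarrow> T = Srt Box \<or> (\<exists>s. typing \<Lambda> \<Gamma> T (Srt s))"
proof (induction rule: typing.induct)
  case (ty_prod \<Gamma> A x B s)
  have "valid_env \<Lambda> \<Gamma>" using typing_valid_env[OF ty_prod.hyps(1)] .
  then show ?case by (cases s) auto
next
  case (ty_app \<Gamma> t A B a)
  then show ?case using PiT_cod_typed by auto
qed (auto intro: types dest: typing.ty_weak)

text \<open>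
  \<open>\<box>\<close> is not typable, so the types introduced by (fun), (app) and (conv) are never \<open>\<box>\<close>.
\<close>

lemma apps_type_typed:
  assumes "typing \<Lambda> \<Gamma> (apps (Nm f) ts) T" "f \<in> syms \<Lambda>"
  shows "\<exists>s. typing \<Lambda> \<Gamma> T (Srt s)"
  using assms
proof (induction \<Gamma> "apps (Nm f) ts" T rule: typing.induct)
  case (ty_fun g)
  then show ?case using types by blast
next
  case (ty_var \<Gamma> A s x)
  then show ?case by (metis typing.ty_weak)
next
  case (ty_weak \<Gamma> T A s x)
  then show ?case by (metis typing.ty_weak)
next
  case (ty_app \<Gamma> t A B a)
  then show ?case using type_correctness[of \<Gamma> t "PiT A B"] PiT_cod_typed by auto
qed (auto simp: eq_commute[of _ "apps _ _"])

section \<open>Injectivity of products up to conversion\<close>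

lemma conv_join:
  assumes "conv \<Lambda> t u"
  obtains v where "(red \<Lambda>)\<^sup>*\<^sup>* t v" "(red \<Lambda>)\<^sup>*\<^sup>* u v"
  using assms semiconfluentp_equivclp[OF confluentp_imp_semiconfluentp[OF confl]]
  unfolding conv_def by (auto simp: rtranclp_conversep)

text \<open>Substitutions fix symbols, so an instance of a left-hand side is still a symbol applied
  to arguments.\<close>

lemma rule_instance_PiT: "\<not> rule_instance \<Lambda> (PiT A B) u"
proof
  assume "rule_instance \<Lambda> (PiT A B) u"
  then obtain l r \<sigma> where lr: "(l, r) \<in> rules \<Lambda>" "is_sub \<Lambda> \<sigma>" "PiT A B = l \<cdot> \<sigma>"
    by (auto simp: rule_instance_def)
  with heads obtain f ts where f: "f \<in> syms \<Lambda>" "l = apps (Nm f) ts" by blast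
  then have "\<sigma> f = Nm f" using lr(2) disj by (intro is_sub_fixes) auto
  then show False using lr(3) f by (metis apps_subst apps_Nm_neq(1) subst.simps(2))
qed

text \<open>A codomain may have a dangling index and then is no term of the calculus, so codomains
  are compared through all their instances. This form needs no choice of a bound name and composes
  along reductions.\<close>

definition PiT_conv :: "'a trm \<Rightarrow> 'a trm \<Rightarrow> 'a trm \<Rightarrow> 'a trm \<Rightarrow> bool" where
  "PiT_conv A B A' B' \<longleftrightarrow>
     conv \<Lambda> A A' \<and> (\<forall>u. is_trm \<Lambda> u \<longrightarrow> conv \<Lambda> (inst 0 u B) (inst 0 u B'))"

lemma red_PiT:
  assumes "red \<Lambda> (PiT A B) v"
  shows "\<exists>A' B'. v = PiT A' B' \<and> PiT_conv A B A' B'"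
proof -
  obtain P where P: "P = rule_instance \<Lambda> \<or> P = beta_redex \<Lambda>" "ctxt_closure \<Lambda> P (PiT A B) v"
    using assms by (elim red_cases)
  from P(2) show ?thesis
  proof cases
    case root
    then show ?thesis using P(1) rule_instance_PiT by (auto simp: beta_redex_def)
  next
    case (pi_dom A')
    then show ?thesis using P(1) by (auto simp: PiT_conv_def intro: red_conv redI)
  next
    case (pi_cod x B')
    have c: "conv \<Lambda> (inst 0 (Nm x) B) (inst 0 (Nm x) B')"
      using P(1) pi_cod by (blast intro: red_conv redI)
    \<comment> \<open>The step is given at the fresh name \<open>x\<close> only; substituting
      \<open>u\<close> for \<open>x\<close> gives every instance.\<close>
    have "conv \<Lambda> (inst 0 u B) (inst 0 u B')" if u: "is_trm \<Lambda> u" for u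
    proof -
      have "closed_at 0 u" using u by (simp add: is_trm_def)
      then show ?thesis
        using conv_subst[OF is_sub_upd[OF is_sub_Nm \<open>x \<in> vars \<Lambda>\<close> u] c] pi_cod
          inst_Nm_subst[of Nm u x B 0] inst_Nm_subst[of Nm u x B' 0] by simp
    qed
    then show ?thesis using pi_cod by (auto simp: PiT_conv_def)
  qed
qed

lemma reds_PiT:
  "(red \<Lambda>)\<^sup>*\<^sup>* (PiT A B) v \<Longrightarrow> \<exists>A' B'. v = PiT A' B' \<and> PiT_conv A B A' B'"
proof (induction rule: rtranclp_induct)
  case base
  then show ?case by (auto simp: PiT_conv_def)
next
  case (step v w)
  then obtain A' B' where 1: "v = PiT A' B'" "PiT_conv A B A' B'" by blast
  with step red_PiT obtain A'' B'' where "w = PiT A'' B''" "PiT_conv A' B' A'' B''" by blast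
  with 1 have "w = PiT A'' B''" "PiT_conv A B A'' B''"
    unfolding PiT_conv_def by (meson conv_trans)+
  then show ?case by blast
qed

text \<open>By confluence both products reduce to a common term. This term is again a product, whose
  domain and codomain instances are convertible to those of either side.\<close>

lemma conv_PiT_PiT:
  assumes "conv \<Lambda> (PiT A B) (PiT A' B')"
  shows "conv \<Lambda> A A'" "is_trm \<Lambda> u \<Longrightarrow> conv \<Lambda> (inst 0 u B) (inst 0 u B')"
proof -
  obtain v where "(red \<Lambda>)\<^sup>*\<^sup>* (PiT A B) v" "(red \<Lambda>)\<^sup>*\<^sup>* (PiT A' B') v"
    using conv_join[OF assms] .
  then obtain C D where "PiT_conv A B C D" "PiT_conv A' B' C D" using reds_PiT by blast
  then show "conv \<Lambda> A A'" "is_trm \<Lambda> u \<Longrightarrow> conv \<Lambda> (inst 0 u B) (inst 0 u B')"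
    unfolding PiT_conv_def by (meson conv_trans conv_sym)+
qed

text \<open>Generation makes both derivations follow the term. Injectivity of products enters for
  applications, where two types of the function must give convertible results.\<close>

lemma unique_types:
  "typing \<Lambda> \<Gamma> t T \<Longrightarrow> typing \<Lambda> \<Gamma> t T' \<Longrightarrow> conv \<Lambda> T T'"
\<comment> \<open>An opened body is not a subterm, but opening at a name preserves the size.\<close>
proof (induction t arbitrary: \<Gamma> T T' rule: measure_induct_rule[of size])
  case (less t)
  show ?case
  proof (cases t)
    case (Srt s)
    then show ?thesis using less.prems Srt_typed by (meson conv_trans conv_sym)
  next
    case (Nm x)
    show ?thesis
    proof (cases "x \<in> syms \<Lambda>")
      case True
      then show ?thesis using less.prems Nm Nm_sym_typed by (meson conv_trans conv_sym)
    next
      case False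
      then have "x \<in> vars \<Lambda>" using typing_is_trm(1)[OF less.prems(1)] Nm by auto
      with less.prems Nm Nm_var_typed obtain A A' where
        A: "(x, A) \<in> set \<Gamma>" "(x, A') \<in> set \<Gamma>" "conv \<Lambda> A T" "conv \<Lambda> A' T'" by metis
      then have "A = A'"
        using valid_env_distinct[OF typing_valid_env[OF less.prems(1)]] eq_key_imp_eq_value by metis
      then show ?thesis using A by (meson conv_trans conv_sym)
    qed
  next
    case (Bnd i)
    then show ?thesis using typing_closed[OF less.prems(1)] by simp
  next
    case (LamT A b)
    obtain B s where B: "conv \<Lambda> (PiT A B) T" "typing \<Lambda> \<Gamma> (PiT A B) (Srt s)" and
      b: "\<And>z. z \<in> vars \<Lambda> \<and> z \<notin> fst ` set \<Gamma> \<Longrightarrow> z \<notin> names b \<Longrightarrow> z \<notin> names B \<Longrightarrow>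
        typing \<Lambda> ((z, A) # \<Gamma>) (inst 0 (Nm z) b) (inst 0 (Nm z) B)"
      using LamT_typed less.prems(1) LamT by meson
    obtain B' s' where B': "conv \<Lambda> (PiT A B') T'" and
      b': "\<And>z. z \<in> vars \<Lambda> \<and> z \<notin> fst ` set \<Gamma> \<Longrightarrow> z \<notin> names b \<Longrightarrow> z \<notin> names B' \<Longrightarrow>
        typing \<Lambda> ((z, A) # \<Gamma>) (inst 0 (Nm z) b) (inst 0 (Nm z) B')"
      using LamT_typed less.prems(2) LamT by meson
    obtain z where z: "z \<in> vars \<Lambda>" "z \<notin> fst ` set \<Gamma> \<union> names b \<union> names B \<union> names B'"
      using fresh[of "fst ` set \<Gamma> \<union> names b \<union> names B \<union> names B'"] by auto
    have "conv \<Lambda> (inst 0 (Nm z) B) (inst 0 (Nm z) B')"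
      using less.IH[of "inst 0 (Nm z) b"] b[of z] b'[of z] z LamT by auto
    moreover have "is_trm \<Lambda> A" using typing_is_trm(1)[OF B(2)] by (simp add: is_trm_PiT)
    ultimately have "conv \<Lambda> (PiT A B) (PiT A B')" using z by (auto intro: conv_PiT_cod[of z])
    then show ?thesis using B B' by (meson conv_trans conv_sym)
  next
    case (AppT u a)
    obtain A B where 1: "typing \<Lambda> \<Gamma> u (PiT A B)" "typing \<Lambda> \<Gamma> a A" "conv \<Lambda> (inst 0 a B) T"
      using AppT_typed less.prems(1) AppT by blast
    obtain A' B' where 2: "typing \<Lambda> \<Gamma> u (PiT A' B')" "conv \<Lambda> (inst 0 a B') T'"
      using AppT_typed less.prems(2) AppT by blast
    have "conv \<Lambda> (PiT A B) (PiT A' B')" using less.IH[of u] 1 2 AppT by auto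
    then have "conv \<Lambda> (inst 0 a B) (inst 0 a B')"
      using conv_PiT_PiT(2) typing_is_trm(1)[OF 1(2)] by blast
    then show ?thesis using 1 2 by (meson conv_trans conv_sym)
  next
    case (PiT A B)
    obtain s where s: "conv \<Lambda> (Srt s) T" and
      b: "\<And>z. z \<in> vars \<Lambda> \<and> z \<notin> fst ` set \<Gamma> \<Longrightarrow> z \<notin> names B \<Longrightarrow>
        typing \<Lambda> ((z, A) # \<Gamma>) (inst 0 (Nm z) B) (Srt s)"
      using PiT_typed less.prems(1) PiT by meson
    obtain s' where s': "conv \<Lambda> (Srt s') T'" and
      b': "\<And>z. z \<in> vars \<Lambda> \<and> z \<notin> fst ` set \<Gamma> \<Longrightarrow> z \<notin> names B \<Longrightarrow>
        typing \<Lambda> ((z, A) # \<Gamma>) (inst 0 (Nm z) B) (Srt s')"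
      using PiT_typed less.prems(2) PiT by meson
    obtain z where z: "z \<in> vars \<Lambda>" "z \<notin> fst ` set \<Gamma> \<union> names B"
      using fresh[of "fst ` set \<Gamma> \<union> names B"] by auto
    have "conv \<Lambda> (Srt s) (Srt s')"
      using less.IH[of "inst 0 (Nm z) B"] b[of z] b'[of z] z PiT by auto
    then show ?thesis using s s' by (meson conv_trans conv_sym)
  qed
qed

end

section \<open>Inferred types of patterns\<close>

lemma closed_at_apps: "closed_at k (apps t ts) \<longleftrightarrow> closed_at k t \<and> (\<forall>u\<in>set ts. closed_at k u)"
  by (induction ts rule: rev_induct) auto

lemma closed_at_sub_of:
  assumes "\<And>t. t \<in> set ts \<Longrightarrow> closed_at 0 t"
  shows "closed_at 0 (sub_of (zip xs ts) a)"
  using assms unfolding sub_of_def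
  by (auto split: option.splits dest!: map_of_SomeD set_zip_rightD)

text \<open>\<open>map_of\<close> lets the first binding win, so the last pair acts as an update
  only if \<open>x\<close> is not bound earlier.\<close>

lemma sub_of_zip_snoc:
  assumes "length xs = length ts" "x \<notin> set xs"
  shows "sub_of (zip (xs @ [x]) (ts @ [t])) = (sub_of (zip xs ts))(x := t)"
proof
  fix a
  have "map_of (zip xs ts) x = None" using map_of_zip_is_None[of xs ts x] assms by blast
  then show "sub_of (zip (xs @ [x]) (ts @ [t])) a = ((sub_of (zip xs ts))(x := t)) a"
    using assms(1)
    by (simp add: sub_of_def map_add_def del: map_of_zip_is_None split: option.splits)
qed

lemma names_subst_sub_of:
  assumes "length xs = length ts"
  shows "names (t \<cdot> sub_of (zip xs ts)) \<subseteq> (names t - set xs) \<union> (\<Union>u\<in>set ts. names u)"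
proof -
  have "names (sub_of (zip xs ts) a) \<subseteq> ({a} - set xs) \<union> (\<Union>u\<in>set ts. names u)" for a
  proof (cases "map_of (zip xs ts) a")
    case None
    then have "a \<notin> set xs" using map_of_zip_is_None[of xs ts a] assms by blast
    then show ?thesis using None by (simp add: sub_of_def)
  next
    case (Some u)
    then have "u \<in> set ts" by (auto dest: map_of_SomeD set_zip_rightD)
    then show ?thesis using Some by (auto simp: sub_of_def)
  qed
  then show ?thesis unfolding names_subst by blast
qed

context typed_calculus
begin

text \<open>Generation for a symbol applied to a whole telescope of arguments. The induction removes
  the last argument, which leaves a telescope ending in \<open>PiT T (bind 0 x U)\<close>;
  injectivity of products relates the type that generation finds to this declared one.\<close>

lemma apps_spine:
  assumes "f \<in> syms \<Lambda>" "type_of \<Lambda> f = pis xTs U" "distinct (map fst xTs)"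
    "fst ` set xTs \<subseteq> vars \<Lambda>" "closed_at 0 U" "\<forall>(x, T) \<in> set xTs. closed_at 0 T"
    "length us = length xTs" "typing \<Lambda> \<Gamma> (apps (Nm f) us) A"
    "\<theta> = sub_of (zip (map fst xTs) us)"
  shows "conv \<Lambda> (U \<cdot> \<theta>) A \<and> (\<exists>s. typing \<Lambda> \<Gamma> (U \<cdot> \<theta>) (Srt s)) \<and>
    (\<forall>i<length xTs. typing \<Lambda> \<Gamma> (us ! i) (snd (xTs ! i) \<cdot> \<theta>) \<and>
      typing \<Lambda> \<Gamma> (snd (xTs ! i) \<cdot> \<theta>) (Srt Star))"
  using assms(2-)
proof (induction xTs arbitrary: U us A \<theta> rule: rev_induct)
  case Nil
  have "\<theta> = Nm" using Nil by (auto simp: sub_of_def)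
  moreover have "typing \<Lambda> \<Gamma> (type_of \<Lambda> f) (Srt (sort_of \<Lambda> f))"
    using types[OF assms(1)] typing_valid_env[OF Nil.prems(7)] by (rule typing_weaken_Nil)
  moreover have "typing \<Lambda> \<Gamma> (Nm f) A" using Nil by simp
  ultimately show ?case using Nm_sym_typed[OF _ assms(1)] Nil.prems(1) by auto
next
  case (snoc p xTs)
  obtain x T where p: "p = (x, T)" by (cases p)
  obtain us' u where us: "us = us' @ [u]" "length us' = length xTs"
    using snoc.prems(6) by (cases us rule: rev_cases) auto
  let ?U = "PiT T (bind 0 x U)"
  define \<theta>' where "\<theta>' = sub_of (zip (map fst xTs) us')"
  have ty: "type_of \<Lambda> f = pis xTs ?U" using snoc.prems(1) by (simp add: p pis_snoc)
  have x: "x \<notin> fst ` set xTs" "x \<in> vars \<Lambda>" using snoc.prems p by auto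
  then have xs: "x \<notin> syms \<Lambda>" using disj by blast
  have \<theta>: "\<theta> = \<theta>'(x := u)"
    using snoc.prems(8) x(1) us sub_of_zip_snoc[of "map fst xTs" us' x u]
    unfolding \<theta>'_def by (simp add: p del: fun_upd_apply)
  have closed: "closed_at 0 (\<theta>' a)" for a unfolding \<theta>'_def
    using typing_closed[OF snoc.prems(7)] us by (intro closed_at_sub_of) (auto simp: closed_at_apps)
  obtain A1 B1 where app: "typing \<Lambda> \<Gamma> (apps (Nm f) us') (PiT A1 B1)" "typing \<Lambda> \<Gamma> u A1"
    "conv \<Lambda> (inst 0 u B1) A"
    using AppT_typed snoc.prems(7) unfolding us(1) apps_snoc by blast
  have "closed_at 0 T" "closed_at 0 U" using snoc.prems p by auto
  then have "closed_at 0 ?U" by (auto intro: closed_at_bind)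
  from snoc.IH[OF ty _ _ this _ us(2) app(1) \<theta>'_def] snoc.prems obtain s where
    IH: "conv \<Lambda> (PiT (T \<cdot> \<theta>') (bind 0 x U \<cdot> \<theta>')) (PiT A1 B1)"
      "typing \<Lambda> \<Gamma> (PiT (T \<cdot> \<theta>') (bind 0 x U \<cdot> \<theta>')) (Srt s)"
      "\<And>i. i < length xTs \<Longrightarrow> typing \<Lambda> \<Gamma> (us' ! i) (snd (xTs ! i) \<cdot> \<theta>') \<and>
        typing \<Lambda> \<Gamma> (snd (xTs ! i) \<cdot> \<theta>') (Srt Star)"
    by auto
  have T: "typing \<Lambda> \<Gamma> (T \<cdot> \<theta>') (Srt Star)" using PiT_dom_typed[OF IH(2)] .
  \<comment> \<open>Generation gives \<open>u\<close> some type \<open>A1\<close>; the declared type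
    is convertible to it and typable as the domain of a typable product, so (conv) applies.\<close>
  have u: "typing \<Lambda> \<Gamma> u (T \<cdot> \<theta>')"
    using app(2) T conv_sym[OF conv_PiT_PiT(1)[OF IH(1)]] by (rule ty_conv)
  have U: "inst 0 u (bind 0 x U \<cdot> \<theta>') = U \<cdot> \<theta>"
    using inst_bind_subst[OF closed \<open>closed_at 0 U\<close>] \<theta> by simp
  \<comment> \<open>A domain mentions only symbols and earlier variables, so binding
    \<open>x\<close> as well does not change its instance.\<close>
  have dom: "V \<cdot> \<theta> = V \<cdot> \<theta>'" if "V = snd ((xTs @ [p]) ! i)" "i < Suc (length xTs)" for V i
  proof (rule subst_cong)
    fix a assume "a \<in> names V"
    moreover have "names V \<subseteq> syms \<Lambda> \<union> fst ` set xTs"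
      using names_pis_dom[of i "xTs @ [p]" U] names_type_of[OF assms(1)] snoc.prems(1) that
        set_take_subset[of i xTs] by fastforce
    ultimately show "\<theta> a = \<theta>' a" using x xs \<theta> by auto
  qed
  have "conv \<Lambda> (U \<cdot> \<theta>) A"
    using conv_trans[OF conv_PiT_PiT(2)[OF IH(1) typing_is_trm(1)[OF u]] app(3)] U by simp
  moreover have "\<exists>s. typing \<Lambda> \<Gamma> (U \<cdot> \<theta>) (Srt s)" using PiT_cod_typed[OF IH(2) u] U by simp
  moreover have "typing \<Lambda> \<Gamma> (us ! i) (snd ((xTs @ [p]) ! i) \<cdot> \<theta>) \<and>
      typing \<Lambda> \<Gamma> (snd ((xTs @ [p]) ! i) \<cdot> \<theta>) (Srt Star)" if "i < Suc (length xTs)" for i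
    using IH(3)[of i] u T that us p dom[OF refl that]
    by (cases "i < length xTs") (auto simp: nth_append less_Suc_eq)
  ultimately show ?case by simp
qed

lemma has_prod_names:
  assumes "f \<in> syms \<Lambda>" "has_prod \<Lambda> f xTs U"
  shows "names U \<subseteq> syms \<Lambda> \<union> fst ` set xTs"
    and "i < length xTs \<Longrightarrow> names (snd (xTs ! i)) \<subseteq> syms \<Lambda> \<union> fst ` set xTs"
  using names_pis_cod[of U xTs] names_pis_dom[of i xTs U] set_take_subset[of i xTs]
    names_type_of[OF assms(1)] assms(2) unfolding has_prod_def by fastforce+

text \<open>\<open>apps_spine\<close> for an instance by \<open>\<sigma>\<close>: substituting the
  arguments and then applying \<open>\<sigma>\<close> amounts to substituting the instantiated
  arguments.\<close>

lemma has_prod_spine: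
  assumes f: "f \<in> syms \<Lambda>" and hp: "has_prod \<Lambda> f xTs U" and len: "length ts = length xTs"
    and \<sigma>: "is_sub \<Lambda> \<sigma>" and t: "typing \<Lambda> \<Gamma> (apps (Nm f) ts \<cdot> \<sigma>) A"
    and \<tau>: "\<tau> = sub_of (zip (map fst xTs) ts)"
  shows "conv \<Lambda> (U \<cdot> \<tau> \<cdot> \<sigma>) A"
    and "i < length xTs \<Longrightarrow> typing \<Lambda> \<Gamma> (ts ! i \<cdot> \<sigma>) (snd (xTs ! i) \<cdot> \<tau> \<cdot> \<sigma>)"
    and "i < length xTs \<Longrightarrow> typing \<Lambda> \<Gamma> (snd (xTs ! i) \<cdot> \<tau> \<cdot> \<sigma>) (Srt Star)"
proof -
  let ?us = "map (\<lambda>t. t \<cdot> \<sigma>) ts"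
  let ?\<theta> = "sub_of (zip (map fst xTs) ?us)"
  \<comment> \<open>Every name here is a telescope variable, which \<open>\<tau>\<close> replaces,
    or else a symbol, which \<open>\<sigma>\<close> fixes.\<close>
  have eq: "V \<cdot> \<tau> \<cdot> \<sigma> = V \<cdot> ?\<theta>" if "names V \<subseteq> syms \<Lambda> \<union> fst ` set xTs" for V
    unfolding subst_subst
  proof (rule subst_cong)
    fix a assume "a \<in> names V"
    then have a: "a \<in> syms \<Lambda> \<or> a \<in> fst ` set xTs" using that by blast
    have map: "map_of (zip (map fst xTs) ?us) a =
      map_option (\<lambda>t. t \<cdot> \<sigma>) (map_of (zip (map fst xTs) ts) a)"
      by (simp add: zip_map2 map_of_map)
    show "\<tau> a \<cdot> \<sigma> = ?\<theta> a"
    proof (cases "map_of (zip (map fst xTs) ts) a")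
      case None
      then have "a \<notin> fst ` set xTs" using map_of_zip_is_None[of "map fst xTs" ts a] len by auto
      then have "\<sigma> a = Nm a" using a disj \<sigma> by (intro is_sub_fixes) auto
      then show ?thesis using None map by (simp add: \<tau> sub_of_def)
    qed (use map in \<open>simp add: \<tau> sub_of_def\<close>)
  qed
  have "\<sigma> f = Nm f" using f disj \<sigma> by (intro is_sub_fixes) auto
  then have "typing \<Lambda> \<Gamma> (apps (Nm f) ?us) A" using t by (simp add: apps_subst)
  moreover have "type_of \<Lambda> f = pis xTs U" "distinct (map fst xTs)" "fst ` set xTs \<subseteq> vars \<Lambda>"
    "closed_at 0 U" "\<forall>(x, T) \<in> set xTs. closed_at 0 T" "length ?us = length xTs"
    using hp len by (auto simp: has_prod_def is_trm_def)
  ultimately have sp: "conv \<Lambda> (U \<cdot> ?\<theta>) A" "\<And>i. i < length xTs \<Longrightarrow>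
      typing \<Lambda> \<Gamma> (?us ! i) (snd (xTs ! i) \<cdot> ?\<theta>) \<and> typing \<Lambda> \<Gamma> (snd (xTs ! i) \<cdot> ?\<theta>) (Srt Star)"
    using apps_spine[OF f, of xTs U ?us \<Gamma> A ?\<theta>] by blast+
  show "conv \<Lambda> (U \<cdot> \<tau> \<cdot> \<sigma>) A" using sp(1) eq[OF has_prod_names(1)[OF f hp]] by simp
  show "typing \<Lambda> \<Gamma> (ts ! i \<cdot> \<sigma>) (snd (xTs ! i) \<cdot> \<tau> \<cdot> \<sigma>)"
    "typing \<Lambda> \<Gamma> (snd (xTs ! i) \<cdot> \<tau> \<cdot> \<sigma>) (Srt Star)" if "i < length xTs"
    using sp(2)[OF that] eq[OF has_prod_names(2)[OF f hp that]] len that by simp_all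
qed

end

locale split_calculus = typed_calculus +
  fixes alg :: "'a set" and hat :: "'a \<Rightarrow> 'a"
  assumes split: "alg_split \<Lambda> alg hat"
begin

lemma alg_vars: "alg \<subseteq> vars \<Lambda>"
  using split by (simp add: alg_split_def)

text \<open>Ensures that the values of a substitution on the variables of \<open>t\<close> and their
  hats decide whether it satisfies \<open>D\<close>. The telescope variables of the symbols do not
  survive, since each is replaced by an argument.\<close>

lemma infer_names:
  "infer \<Lambda> alg hat t T D \<Longrightarrow> names t \<subseteq> syms \<Lambda> \<union> alg \<and>
     names T \<subseteq> syms \<Lambda> \<union> (names t \<union> hat ` (names t \<inter> alg)) \<and>
     (\<forall>(a, b) \<in> D. names a \<union> names b \<subseteq> syms \<Lambda> \<union> (names t \<union> hat ` (names t \<inter> alg)))"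
proof (induction rule: infer.induct)
  case (infer_app f xTs U ts As Es \<sigma>)
  let ?t = "apps (Nm f) ts"
  let ?N = "\<lambda>t. names t \<union> hat ` (names t \<inter> alg)"
  have IH: "names t \<subseteq> syms \<Lambda> \<union> alg" if "t \<in> set ts" for t
    using infer_app.IH infer_app.hyps(3) that by (metis in_set_conv_nth)
  have N: "?N (ts ! i) \<subseteq> ?N ?t" if "i < length xTs" for i
    using that infer_app.hyps(3) nth_mem[of i ts] by (auto simp: names_apps)
  have \<sigma>: "names (V \<cdot> \<sigma>) \<subseteq> syms \<Lambda> \<union> ?N ?t" if "names V \<subseteq> syms \<Lambda> \<union> fst ` set xTs" for V
    using names_subst_sub_of[of "map fst xTs" ts V] infer_app.hyps(3) that
    unfolding \<open>\<sigma> = _\<close> by (auto simp: names_apps)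
  note hp = infer_app.hyps(1,2)
  have "names ?t \<subseteq> syms \<Lambda> \<union> alg" using IH infer_app.hyps(1) by (auto simp: names_apps)
  moreover have "names (U \<cdot> \<sigma>) \<subseteq> syms \<Lambda> \<union> ?N ?t" using \<sigma>[OF has_prod_names(1)[OF hp]] .
  moreover have "names a \<union> names b \<subseteq> syms \<Lambda> \<union> ?N ?t" if "(a, b) \<in> \<Union> (set Es)" for a b
  proof -
    obtain i where i: "i < length xTs" "(a, b) \<in> Es ! i"
      using \<open>(a, b) \<in> \<Union> (set Es)\<close> infer_app.hyps(5) by (auto simp: in_set_conv_nth)
    then show ?thesis using infer_app.IH[OF i(1)] N[OF i(1)] by blast
  qed
  moreover have "names (As ! i) \<union> names (snd (xTs ! i) \<cdot> \<sigma>) \<subseteq> syms \<Lambda> \<union> ?N ?t"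
    if "i < length xTs" for i
    using infer_app.IH[OF that] N[OF that] \<sigma>[OF has_prod_names(2)[OF hp that]] by blast
  ultimately show ?case by blast
qed auto

text \<open>
  An algebraic variable occurs as an argument of some symbol, hence at a type that is the domain
  of a product, and (prod) forces domains to be of sort \<open>\<star>\<close>.
\<close>

lemma infer_var_types:
  assumes "infer \<Lambda> alg hat t T D" "is_sub \<Lambda> \<sigma>"
  shows "typing \<Lambda> \<Gamma> (t \<cdot> \<sigma>) A \<Longrightarrow> t \<notin> Nm ` alg \<or> typing \<Lambda> \<Gamma> A (Srt Star) \<Longrightarrow>
    y \<in> names t \<inter> alg \<Longrightarrow> \<exists>C. typing \<Lambda> \<Gamma> (\<sigma> y) C \<and> typing \<Lambda> \<Gamma> C (Srt Star)"
  using assms(1)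
proof (induction arbitrary: A rule: infer.induct)
  case (infer_var y')
  then show ?case by auto
next
  case (infer_app f xTs U ts As Es \<tau>)
  have "y \<noteq> f" using infer_app.hyps(1) infer_app.prems(3) alg_vars disj by blast
  then obtain i where i: "i < length xTs" "y \<in> names (ts ! i)"
    using infer_app.prems(3) infer_app.hyps(3) by (auto simp: names_apps in_set_conv_nth)
  note sp = has_prod_spine[OF infer_app.hyps(1-3) assms(2) infer_app.prems(1) \<open>\<tau> = _\<close>]
  \<comment> \<open>The declared type of the argument has sort \<open>Star\<close>, being a domain;
    the induction hypothesis asks for this when the argument is itself a variable.\<close>
  show ?case using infer_app.IH[OF i(1) sp(2)[OF i(1)]] sp(3)[OF i(1)] i infer_app.prems by blast
qed

text \<open>For a variable this is uniqueness of types. For an application, the induction hypothesis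
  at the declared type of an argument says exactly that the new equation for this argument is
  satisfied.\<close>

lemma infer_satisfies:
  assumes "infer \<Lambda> alg hat t T D" "is_sub \<Lambda> \<sigma>"
  shows "typing \<Lambda> \<Gamma> (t \<cdot> \<sigma>) A \<Longrightarrow> \<forall>y \<in> names t \<inter> alg. typing \<Lambda> \<Gamma> (\<sigma> y) (\<sigma> (hat y)) \<Longrightarrow>
    conv \<Lambda> (T \<cdot> \<sigma>) A \<and> satisfies \<Lambda> \<sigma> D"
  using assms(1)
proof (induction arbitrary: A rule: infer.induct)
  case (infer_var y)
  then show ?case using unique_types by (auto simp: satisfies_def)
next
  case (infer_app f xTs U ts As Es \<tau>)
  note sp = has_prod_spine[OF infer_app.hyps(1-3) assms(2) infer_app.prems(1) \<open>\<tau> = _\<close>]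
  have IH: "conv \<Lambda> (As ! i \<cdot> \<sigma>) (snd (xTs ! i) \<cdot> \<tau> \<cdot> \<sigma>) \<and> satisfies \<Lambda> \<sigma> (Es ! i)"
    if i: "i < length xTs" for i
  proof (rule infer_app.IH[OF i sp(2)[OF i]])
    show "\<forall>y \<in> names (ts ! i) \<inter> alg. typing \<Lambda> \<Gamma> (\<sigma> y) (\<sigma> (hat y))"
      using infer_app.prems(2) i infer_app.hyps(3) nth_mem[of i ts] by (auto simp: names_apps)
  qed
  have "satisfies \<Lambda> \<sigma> (\<Union> (set Es))"
    using IH infer_app.hyps(5) unfolding satisfies_def
    by (metis (no_types, lifting) UnionE in_set_conv_nth)
  then show ?case using IH sp(1) by (auto simp: satisfies_def)
qed

end

theorem theorem4p13:
  fixes \<Lambda> :: "'a calc" and alg :: "'a set" and hat :: "'a \<Rightarrow> 'a"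
    and S :: "'a eqns \<Rightarrow> 'a eqns \<Rightarrow> bool"
    and l r T :: "'a trm" and D E :: "'a eqns"
  assumes "lp_calculus \<Lambda>"
    and "alg_split \<Lambda> alg hat"
    and "\<forall>f \<in> syms \<Lambda>. typing \<Lambda> [] (type_of \<Lambda> f) (Srt (sort_of \<Lambda> f))"
    and "confluentp (red \<Lambda>)"
    and "\<forall>(g, d) \<in> rules \<Lambda>. pattern \<Lambda> alg g"
    and "valid_simplification \<Lambda> S"
    and "pattern \<Lambda> alg l"
    and "is_eqns \<Lambda> D" and "is_eqns \<Lambda> E"
    and "is_trm \<Lambda> T" and "is_trm \<Lambda> r"
    and "FV \<Lambda> r \<subseteq> FV \<Lambda> l"
    and "infer \<Lambda> alg hat l T D"
    and "S\<^sup>*\<^sup>* D E"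
    and "typing (ext_calc \<Lambda> hat l E) [] r T"
  shows "preserves_typing \<Lambda> l r"
proof -
  from assms interpret split_calculus \<Lambda> alg hat
    by unfold_locales (auto simp: pattern_def, fastforce)
  obtain f ts where f: "f \<in> syms \<Lambda>" "l = apps (Nm f) ts"
    using \<open>pattern \<Lambda> alg l\<close> by (auto simp: pattern_def)
  define X where "X = FV \<Lambda> l"
  define Y where "Y = hat ` X"
  let ?L = "ext_calc \<Lambda> hat l E"
  have L: "syms ?L = syms \<Lambda> \<union> (X \<union> Y)" "vars ?L = vars \<Lambda> - (X \<union> Y)"
    "type_of ?L a = (if a \<in> X then Nm (hat a) else if a \<in> Y then Srt Star else type_of \<Lambda> a)"
    "rules ?L = variants_apart \<Lambda> (X \<union> Y) \<union> E \<union> E\<inverse>" for a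
    by (simp_all add: ext_calc_def X_def Y_def Let_def)
  note inf = infer_names[OF \<open>infer \<Lambda> alg hat l T D\<close>]
  \<comment> \<open>Inference makes every variable of \<open>l\<close> algebraic, so
    \<open>hat\<close> is injective on \<open>X\<close> with values outside
    \<open>X\<close>.\<close>
  have X: "X = names l \<inter> alg" using inf alg_vars disj unfolding X_def FV_def by blast
  have XY: "X \<union> Y \<subseteq> vars \<Lambda>" "X \<inter> Y = {}" "inj_on hat X"
    using split X unfolding Y_def alg_split_def by (auto intro: inj_on_subset)
  have D_names: "names a \<union> names b \<subseteq> syms \<Lambda> \<union> (X \<union> Y)" if "(a, b) \<in> D" for a b
    using inf that unfolding Y_def X by blast
  show ?thesis unfolding preserves_typing_def
  proof (intro allI impI)
    fix \<Gamma> \<sigma> A assume \<sigma>: "is_sub \<Lambda> \<sigma>" and l\<sigma>: "typing \<Lambda> \<Gamma> (l \<cdot> \<sigma>) A"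
    \<comment> \<open>As \<open>l\<close> is headed by a symbol, \<open>infer_var_types\<close>
      applies without knowing the sort of \<open>A\<close>.\<close>
    have "l \<notin> Nm ` alg" using f alg_vars disj by auto
    then have "\<forall>y \<in> X. \<exists>C. typing \<Lambda> \<Gamma> (\<sigma> y) C \<and> typing \<Lambda> \<Gamma> C (Srt Star)"
      using infer_var_types[OF \<open>infer \<Lambda> alg hat l T D\<close> \<sigma> l\<sigma>] X by blast
    then obtain C where C: "\<And>y. y \<in> X \<Longrightarrow> typing \<Lambda> \<Gamma> (\<sigma> y) (C y)"
      "\<And>y. y \<in> X \<Longrightarrow> typing \<Lambda> \<Gamma> (C y) (Srt Star)" by metis
    \<comment> \<open>\<open>hat y\<close> is sent to the chosen type \<open>C y\<close>, with
      \<open>y\<close> recovered by injectivity of \<open>hat\<close>. Elsewhere names are fixed: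
      symbols have to be, and the other variables occur neither in \<open>l\<close> nor in
      \<open>r\<close>.\<close>
    define \<sigma>' where "\<sigma>' a = (if a \<in> X then \<sigma> a else if a \<in> Y then C (inv_into X hat a) else Nm a)"
      for a
    have \<sigma>'_hat: "\<sigma>' (hat y) = C y" if "y \<in> X" for y
      using that XY by (auto simp: \<sigma>'_def Y_def)
    have \<sigma>': "is_sub \<Lambda> \<sigma>'"
    proof -
      have "{a. \<sigma>' a \<noteq> Nm a} \<subseteq> X \<union> Y" by (auto simp: \<sigma>'_def)
      moreover have "finite (X \<union> Y)" by (simp add: X Y_def)
      moreover have "is_trm \<Lambda> (\<sigma>' x)" if "x \<in> vars \<Lambda>" for x
        using that is_sub_trm[OF \<sigma>] typing_is_trm(1)[OF C(2)]
        by (auto simp: \<sigma>'_def inv_into_into Y_def)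
      ultimately show ?thesis using XY(1) unfolding is_sub_def by (blast intro: finite_subset)
    qed
    have \<sigma>_eq: "t \<cdot> \<sigma>' = t \<cdot> \<sigma>" if "names t \<subseteq> syms \<Lambda> \<union> X" for t
    proof (rule subst_cong)
      fix a assume "a \<in> names t"
      then have "a \<in> X \<or> a \<notin> vars \<Lambda>" using that disj by blast
      then show "\<sigma>' a = \<sigma> a"
        using XY(1) is_sub_fixes[OF \<sigma>, of a] by (auto simp: \<sigma>'_def)
    qed
    have l_eq: "l \<cdot> \<sigma>' = l \<cdot> \<sigma>" using inf X by (intro \<sigma>_eq) blast
    have r_eq: "r \<cdot> \<sigma>' = r \<cdot> \<sigma>"
      using \<open>is_trm \<Lambda> r\<close> \<open>FV \<Lambda> r \<subseteq> FV \<Lambda> l\<close>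
      by (intro \<sigma>_eq) (auto simp: is_trm_def FV_def X_def)
    have "\<forall>y \<in> names l \<inter> alg. typing \<Lambda> \<Gamma> (\<sigma>' y) (\<sigma>' (hat y))"
      using C \<sigma>'_hat X by (auto simp: \<sigma>'_def)
    then have T: "conv \<Lambda> (T \<cdot> \<sigma>') A" and D: "satisfies \<Lambda> \<sigma>' D"
      using infer_satisfies[OF \<open>infer \<Lambda> alg hat l T D\<close> \<sigma>'] l\<sigma> l_eq by auto
    text \<open>
      The equations \<open>E\<close> may contain variables other than those of \<open>l\<close>, so \<open>\<sigma>'\<close> alone does not
      suffice; but \<open>D\<close> contains no others, hence every substitution agreeing with \<open>\<sigma>'\<close>
      on the variables of \<open>D\<close> satisfies \<open>D\<close>, and therefore \<open>E\<close>.
    \<close>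
    have E: "satisfies \<Lambda> \<theta> E" if \<theta>: "is_sub \<Lambda> \<theta>" "\<forall>a \<in> X \<union> Y. \<theta> a = \<sigma>' a" for \<theta>
    proof -
      have "a \<cdot> \<theta> = a \<cdot> \<sigma>'" if "names a \<subseteq> syms \<Lambda> \<union> (X \<union> Y)" for a
      proof (rule subst_cong)
        fix b assume "b \<in> names a"
        then have "b \<in> X \<union> Y \<or> b \<notin> vars \<Lambda>" using that disj by blast
        then show "\<theta> b = \<sigma>' b"
          using \<theta>(2) is_sub_fixes[OF \<theta>(1), of b] is_sub_fixes[OF \<sigma>', of b] by auto
      qed
      then have "satisfies \<Lambda> \<theta> D" using D D_names unfolding satisfies_def by fastforce
      with \<open>S\<^sup>*\<^sup>* D E\<close> show ?thesis
        by (induction rule: rtranclp_induct)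
          (use \<open>valid_simplification \<Lambda> S\<close> \<theta> in \<open>auto simp: valid_simplification_def\<close>)
    qed
    \<comment> \<open>The values on the new symbols \<open>X \<union> Y\<close> are frozen, while
      the remaining variables stay free, since they are renamed under binders.\<close>
    define G where "G \<theta> \<longleftrightarrow> is_sub \<Lambda> \<theta> \<and> (\<forall>a \<in> X \<union> Y. \<theta> a = \<sigma>' a)" for \<theta>
    interpret ext: translation \<Lambda> ?L G
    proof
      show "closed_at 0 (\<theta> a)" if "G \<theta>" for \<theta> a
        using that is_sub_closed by (auto simp: G_def)
      show "is_trm \<Lambda> (\<theta> a)" if "G \<theta>" "a \<in> syms ?L \<union> vars ?L" for \<theta> a
        using that XY(1) is_sub_trm[of \<Lambda> \<theta> a] by (auto simp: G_def L)
      show "G (\<theta>(x := Nm z))" if "G \<theta>" "x \<in> vars ?L" "z \<in> vars \<Lambda>" for \<theta> x z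
        using that by (auto simp: G_def L intro: is_sub_upd)
      show "syms ?L \<inter> vars ?L = {}" using disj by (auto simp: L)
      show "names (type_of ?L g) \<subseteq> syms ?L" if "g \<in> syms ?L" for g
        using that names_type_of XY(1) disj by (auto simp: L Y_def)
      show "conv \<Lambda> (t \<cdot> \<theta>) (u \<cdot> \<theta>)" if \<theta>: "G \<theta>" and tu: "rule_instance ?L t u" for \<theta> t u
      proof -
        obtain g d \<tau> where gd: "(g, d) \<in> rules ?L" "is_sub ?L \<tau>" "t = g \<cdot> \<tau>" "u = d \<cdot> \<tau>"
          using tu by (auto simp: rule_instance_def)
        \<comment> \<open>Instantiating by \<open>\<tau>\<close> and translating by
          \<open>\<theta>\<close> is a single substitution of \<open>\<Lambda>\<close>. The names in
          \<open>X \<union> Y\<close> are symbols of \<open>?L\<close>, hence fixed by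
          \<open>\<tau>\<close>, so the composite agrees with \<open>\<sigma>'\<close> there and
          satisfies \<open>E\<close>.\<close>
        let ?\<theta> = "\<lambda>a. \<tau> a \<cdot> \<theta>"
        have "is_sub \<Lambda> \<tau>"
        proof -
          have "is_trm \<Lambda> t" if "is_trm ?L t" for t
            using that XY(1) unfolding is_trm_def L by blast
          moreover have "is_trm ?L (\<tau> x)" if "x \<in> vars \<Lambda>" for x
            using that by (intro is_sub_trm[OF gd(2)]) (auto simp: L(1,2))
          ultimately have "is_trm \<Lambda> (\<tau> x)" if "x \<in> vars \<Lambda>" for x
            using that by simp
          then show ?thesis using gd(2) unfolding is_sub_def L(2) by auto
        qed
        moreover have "is_sub \<Lambda> \<theta>" using \<theta> by (simp add: G_def)
        ultimately have sub: "is_sub \<Lambda> ?\<theta>" by (rule is_sub_comp)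
        have eq: "t \<cdot> \<theta> = g \<cdot> ?\<theta>" "u \<cdot> \<theta> = d \<cdot> ?\<theta>" using gd by (simp_all add: subst_subst)
        have "?\<theta> a = \<sigma>' a" if "a \<in> X \<union> Y" for a
          using that \<theta> is_sub_fixes[OF gd(2), of a] by (auto simp: G_def L)
        then have sat: "satisfies \<Lambda> ?\<theta> E" using sub E by blast
        \<comment> \<open>An instance of a renamed rule is an instance of the original rule.\<close>
        have var: "conv \<Lambda> (g \<cdot> ?\<theta>) (d \<cdot> ?\<theta>)" if "(g, d) \<in> variants_apart \<Lambda> (X \<union> Y)"
        proof -
          from that obtain g' d' \<rho> where "(g', d') \<in> rules \<Lambda>" "is_sub \<Lambda> \<rho>" "g = g' \<cdot> \<rho>" "d = d' \<cdot> \<rho>"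
            by (auto simp: variants_apart_def renaming_def)
          then have "rule_instance \<Lambda> g d" by (auto simp: rule_instance_def)
          then show ?thesis using rule_instance_subst[OF _ sub] rule_instance_conv by blast
        qed
        have "(g, d) \<in> variants_apart \<Lambda> (X \<union> Y) \<or> (g, d) \<in> E \<or> (d, g) \<in> E"
          using gd(1) unfolding L(4) by blast
        then show ?thesis
          using var sat conv_sym unfolding eq satisfies_def by blast
      qed
    qed
    have "ext.well_typed_map \<Gamma> \<sigma>' []" unfolding ext.well_typed_map_def
    proof (intro conjI ballI)
      show "G \<sigma>'" using \<sigma>' by (simp add: G_def)
      show "valid_env \<Lambda> \<Gamma>" using l\<sigma> by (rule typing_valid_env)
      show "typing \<Lambda> \<Gamma> (\<sigma>' g) (type_of ?L g \<cdot> \<sigma>')" if g: "g \<in> syms ?L" for g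
      proof -
        \<comment> \<open>A variable \<open>y\<close> of \<open>l\<close> goes to a term of type
          \<open>C y\<close>, \<open>hat y\<close> to \<open>C y\<close> of type
          \<open>Star\<close>, and an old symbol to itself, its type containing no
          variables.\<close>
        consider "g \<in> X" | y where "y \<in> X" "g = hat y" "g \<in> Y" "g \<notin> X"
          | "g \<in> syms \<Lambda>" "g \<notin> X" "g \<notin> Y"
          using g unfolding L(1) Y_def by blast
        then show ?thesis
        proof cases
          case 1
          then show ?thesis using C(1) \<sigma>'_hat by (simp add: L \<sigma>'_def)
        next
          case 2
          then show ?thesis using C(2) \<sigma>'_hat by (simp add: L)
        next
          case 3
          have "typing \<Lambda> \<Gamma> (Nm g) (type_of \<Lambda> g)"
            using ty_fun[OF 3(1) types[OF 3(1)]] typing_valid_env[OF l\<sigma>] by (rule typing_weaken_Nil)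
          then show ?thesis
            using 3 subst_fixes[OF \<sigma>' names_type_of[OF 3(1)]] by (simp add: L \<sigma>'_def)
        qed
      qed
    qed simp
    then have "typing \<Lambda> \<Gamma> (r \<cdot> \<sigma>) (T \<cdot> \<sigma>')"
      using ext.typing_translate[OF \<open>typing ?L [] r T\<close>] r_eq by metis
    moreover have "\<exists>s. typing \<Lambda> \<Gamma> A (Srt s)"
    proof -
      have "\<sigma> f = Nm f" using f disj \<sigma> by (intro is_sub_fixes) auto
      then show ?thesis using l\<sigma> f apps_type_typed by (simp add: apps_subst)
    qed
    ultimately show "typing \<Lambda> \<Gamma> (r \<cdot> \<sigma>) A" using T ty_conv by metis
  qed
qed

end
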